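(* Let $(H,\omega)$ be a real separable symplectic Hilbert space, $\lambda\subset H$ a Lagrangian subspace, and $\{\mu_t\}_{t\in[0,1]}$ a continuous curve in $\mathcal{FL}_\lambda(H)$. Let $H\boxplus H=H_\omega\oplus H_{-\omega}$ and let $\Delta\subset H\boxplus H$ be the diagonal. Then $$\mathbf{Mas}(\{\mu_t\},\lambda)=\mathbf{Mas}(\{\mu_t\boxplus\lambda\},\Delta).$$
   Context: $H\boxplus H$ is $H\oplus H$ with the symplectic form $\Omega(x\boxplus y,u\boxplus v)=\omega(x,u)-\omega(y,v)$ and almost complex structure $J\oplus(-J)$; $\Delta$ is a Lagrangian subspace and $\mu_t\boxplus\lambda$ (direct sum of $\mu_t$ in the first factor and $\lambda$ in the second) lies in $\mathcal{FL}_\Delta(H\boxplus H)$. Maslov index: let $(\mathcal H,\langle\cdot,\cdot\rangle,\omega)$ be a real separable symplectic Hilbert space, with inner product (chosen within its equivalence class) such that $\omega(x,y)=\langle Jx,y\rangle$, $J^2=-\operatorname{Id}$, ${}^tJ=-J$. Let $\mathcal L(\mathcal H)$ be the set of Lagrangian subspaces, topologized by the operator norm of orthogonal projections. For $\lambda\in\mathcal L(\mathcal H)$, $\mathcal{FL}_\lambda(\mathcal H)$ is the set of $\mu\in\mathcal L(\mathcal H)$ such that $(\mu,\lambda)$ is a Fredholm pair ($\dim\mu\cap\lambda<\infty$, $\mu+\lambda$ closed of finite codimension). Let $\mathcal H_J$ be $\mathcal H$ viewed as a complex Hilbert space with multiplication by $\sqrt{-1}$ given by $J$ and Hermitian product $\langle\cdot,\cdot\rangle-\sqrt{-1}\,\omega(\cdot,\cdot)$,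 and $\tau_\lambda(x+Jy)=x-Jy$ for $x,y\in\lambda$. Every $\mu\in\mathcal L(\mathcal H)$ is $\mu=U(\lambda^\perp)$ for some unitary $U$ on $\mathcal H_J$; put $\mathcal S_\lambda(\mu)=U\tau_\lambda U^*\tau_\lambda$ (independent of $U$). For $\mu\in\mathcal{FL}_\lambda(\mathcal H)$ it lies in $\mathcal U_{\mathcal F}(\mathcal H_J)=\{W \text{ unitary on }\mathcal H_J : W+\operatorname{Id}\text{ Fredholm}\}$. For a continuous path $\{W(t)\}_{t\in[0,1]}$ in $\mathcal U_{\mathcal F}(\mathcal H_J)$ choose a partition $0=t_0<\dots<t_N=1$ and $0<\varepsilon_j<\pi$ such that for $t\in[t_{j-1},t_j]$ the operator $W(t)-e^{\sqrt{-1}(\pi+\varepsilon_j)}$ is invertible and the spectrum of $W(t)$ in $\{e^{\sqrt{-1}(\pi+\theta)}:|\theta|\le\varepsilon_j\}$ consists of finitely many eigenvalues of finite multiplicity; with $k(t,\varepsilon_j)=\sum_{0\le\theta\le\varepsilon_j}\dim\operatorname{Ker}(W(t)-e^{\sqrt{-1}(\pi+\theta)})$ put $\mathbf M(\{W(t)\})=\sum_{j=1}^N(k(t_j,\varepsilon_j)-k(t_{j-1},\varepsilon_j))$. For a continuous path $\{\mu(t)\}$ in $\mathcal{FL}_\lambda(\mathcal H)$, $\mathbf{Mas}(\{\mu(t)\},\lambda)=\mathbf M(\{\mathcal S_\lambda(\mu(t))\})$. *)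

theory Defs
  imports "HOL-Analysis.Analysis"
begin

section \<open>Symplectic Hilbert spaces and Lagrangian subspaces\<close>

text \<open>The Hilbert space is a whole type of sort \<open>{real_inner, complete_space}\<close>, whose inner
  product is the chosen compatible one.  The conditions on \<open>J\<close> make \<open>\<omega>\<close> a bounded
  skew-symmetric form for which \<open>x \<mapsto> \<omega> x\<close> is an isomorphism onto the dual space.\<close>

definition symplectic_hilbert ::
    "('a::{real_inner, complete_space} \<Rightarrow> 'a \<Rightarrow> real) \<Rightarrow> ('a \<Rightarrow> 'a) \<Rightarrow> bool" where
  "symplectic_hilbert \<omega> J \<longleftrightarrow>
     bounded_linear J \<and>
     (\<forall>x y. \<omega> x y = J x \<bullet> y) \<and>
     (\<forall>x. J (J x) = - x) \<and>
     (\<forall>x y. J x \<bullet> y = x \<bullet> (- J y))"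

definition lagrangian :: "('a::real_inner \<Rightarrow> 'a \<Rightarrow> real) \<Rightarrow> 'a set \<Rightarrow> bool" where
  "lagrangian \<omega> L \<longleftrightarrow> subspace L \<and> closed L \<and> {x. \<forall>y\<in>L. \<omega> x y = 0} = L"

text \<open>\<open>dim\<close> is \<open>0\<close> on infinite-dimensional spaces, so finiteness of dimension and of codimension
  is stated through finite spanning sets.\<close>

definition fredholm_pair :: "'a::real_normed_vector set \<Rightarrow> 'a set \<Rightarrow> bool" where
  "fredholm_pair M L \<longleftrightarrow>
     (\<exists>B. finite B \<and> span B = M \<inter> L) \<and>
     closed {x + y |x y. x \<in> M \<and> y \<in> L} \<and>
     (\<exists>B. finite B \<and> span ({x + y |x y. x \<in> M \<and> y \<in> L} \<union> B) = UNIV)"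

definition fredholm_lagrangian ::
    "('a::real_inner \<Rightarrow> 'a \<Rightarrow> real) \<Rightarrow> 'a set \<Rightarrow> 'a set set" where
  "fredholm_lagrangian \<omega> L = {M. lagrangian \<omega> M \<and> fredholm_pair M L}"

definition orth_proj :: "'a::real_inner set \<Rightarrow> 'a \<Rightarrow> 'a" where
  "orth_proj S x = (THE p. p \<in> S \<and> (\<forall>y\<in>S. orthogonal (x - p) y))"

text \<open>The norm of \<^typ>\<open>'a \<Rightarrow>\<^sub>L 'a\<close> is the operator norm.\<close>

definition continuous_path :: "(real \<Rightarrow> 'a::real_inner set) \<Rightarrow> bool" where
  "continuous_path \<mu> \<longleftrightarrow> continuous_on {0..1} (\<lambda>t. Blinfun (orth_proj (\<mu> t)))"


section \<open>The complex Hilbert space \<open>\<H>\<^sub>J\<close>\<close>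

definition jscale :: "('a \<Rightarrow> 'a) \<Rightarrow> complex \<Rightarrow> 'a \<Rightarrow> 'a::real_vector" where
  "jscale J c x = Re c *\<^sub>R x + Im c *\<^sub>R J x"

lemma vector_space_jscale:
  assumes "symplectic_hilbert \<omega> J"
  shows "vector_space (jscale J)"
proof -
  have l: "linear J" and j: "\<And>x. J (J x) = - x"
    using assms by (auto simp: symplectic_hilbert_def bounded_linear.linear)
  show ?thesis
    by unfold_locales
      (simp_all add: jscale_def linear_add[OF l] linear_scale[OF l] j algebra_simps)
qed

definition herm :: "('a::real_inner \<Rightarrow> 'a \<Rightarrow> real) \<Rightarrow> 'a \<Rightarrow> 'a \<Rightarrow> complex" where
  "herm \<omega> x y = complex_of_real (x \<bullet> y) - \<i> * complex_of_real (\<omega> x y)"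

definition unitary_op ::
    "('a::real_inner \<Rightarrow> 'a \<Rightarrow> real) \<Rightarrow> ('a \<Rightarrow> 'a) \<Rightarrow> ('a \<Rightarrow> 'a) \<Rightarrow> bool" where
  "unitary_op \<omega> J U \<longleftrightarrow>
     bounded_linear U \<and> (\<forall>c x. U (jscale J c x) = jscale J c (U x)) \<and> surj U \<and>
     (\<forall>x y. herm \<omega> (U x) (U y) = herm \<omega> x y)"

definition herm_adjoint ::
    "('a::real_inner \<Rightarrow> 'a \<Rightarrow> real) \<Rightarrow> ('a \<Rightarrow> 'a) \<Rightarrow> 'a \<Rightarrow> 'a" where
  "herm_adjoint \<omega> U = (SOME V. \<forall>x y. herm \<omega> (U x) y = herm \<omega> x (V y))"

definition lagr_conj :: "('a \<Rightarrow> 'a) \<Rightarrow> 'a set \<Rightarrow> 'a \<Rightarrow> 'a::real_vector" where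
  "lagr_conj J L z = (THE w. \<exists>x\<in>L. \<exists>y\<in>L. z = x + J y \<and> w = x - J y)"

text \<open>The operator \<open>U \<tau> U\<^sup>* \<tau>\<close> does not depend on the unitary \<open>U\<close> carrying
  the orthogonal complement of \<open>L\<close> to \<open>M\<close>; this justifies the definite description.\<close>

definition souriau ::
    "('a::real_inner \<Rightarrow> 'a \<Rightarrow> real) \<Rightarrow> ('a \<Rightarrow> 'a) \<Rightarrow> 'a set \<Rightarrow> 'a set \<Rightarrow> 'a \<Rightarrow> 'a" where
  "souriau \<omega> J L M = (THE W. \<exists>U. unitary_op \<omega> J U \<and> M = U ` (L\<^sup>\<bottom>) \<and>
     W = U \<circ> lagr_conj J L \<circ> herm_adjoint \<omega> U \<circ> lagr_conj J L)"


section \<open>The Maslov index\<close>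

definition invertible_op :: "('a::real_normed_vector \<Rightarrow> 'a) \<Rightarrow> bool" where
  "invertible_op T \<longleftrightarrow> (\<exists>S. bounded_linear S \<and> S \<circ> T = id \<and> T \<circ> S = id)"

definition spectrum_op :: "('a \<Rightarrow> 'a) \<Rightarrow> ('a::real_normed_vector \<Rightarrow> 'a) \<Rightarrow> complex set" where
  "spectrum_op J W = {z. \<not> invertible_op (\<lambda>x. W x - jscale J z x)}"

definition eigenspace :: "('a \<Rightarrow> 'a) \<Rightarrow> ('a::real_vector \<Rightarrow> 'a) \<Rightarrow> complex \<Rightarrow> 'a set" where
  "eigenspace J W z = {x. W x - jscale J z x = 0}"

text \<open>Dimensions of eigenspaces are complex dimensions.  The sum is restricted to the \<open>\<theta>\<close> with
  a nonzero kernel, since \<^const>\<open>sum\<close> vanishes on infinite index sets.\<close>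

definition maslov_count :: "('a \<Rightarrow> 'a) \<Rightarrow> ('a::real_vector \<Rightarrow> 'a) \<Rightarrow> real \<Rightarrow> nat" where
  "maslov_count J W \<epsilon> =
     (\<Sum>\<theta> | 0 \<le> \<theta> \<and> \<theta> \<le> \<epsilon> \<and> eigenspace J W (cis (pi + \<theta>)) \<noteq> {0}.
        vector_space.dim (jscale J) (eigenspace J W (cis (pi + \<theta>))))"

definition maslov_partition ::
    "('a \<Rightarrow> 'a) \<Rightarrow> (real \<Rightarrow> 'a::real_normed_vector \<Rightarrow> 'a) \<Rightarrow>
     nat \<Rightarrow> (nat \<Rightarrow> real) \<Rightarrow> (nat \<Rightarrow> real) \<Rightarrow> bool" where
  "maslov_partition J W N t \<epsilon> \<longleftrightarrow>
     t 0 = 0 \<and> t N = 1 \<and>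
     (\<forall>j\<in>{1..N}. t (j - 1) < t j \<and> 0 < \<epsilon> j \<and> \<epsilon> j < pi \<and>
       (\<forall>s\<in>{t (j - 1)..t j}.
          invertible_op (\<lambda>x. W s x - jscale J (cis (pi + \<epsilon> j)) x) \<and>
          (let A = spectrum_op J (W s) \<inter> {cis (pi + \<theta>) |\<theta>. \<bar>\<theta>\<bar> \<le> \<epsilon> j} in
           finite A \<and>
           (\<forall>z\<in>A. eigenspace J (W s) z \<noteq> {0} \<and>
              (\<exists>B. finite B \<and> module.span (jscale J) B = eigenspace J (W s) z)))))"

text \<open>For a continuous path of unitary operators \<open>W t\<close> with \<open>W t + Id\<close> Fredholm, the sum exists
  and is independent of the partition and of the \<open>\<epsilon> j\<close>.\<close>

definition maslov_M :: "('a \<Rightarrow> 'a) \<Rightarrow> (real \<Rightarrow> 'a::real_normed_vector \<Rightarrow> 'a) \<Rightarrow> int" where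
  "maslov_M J W = (THE m. \<exists>N t \<epsilon>. maslov_partition J W N t \<epsilon> \<and>
     m = (\<Sum>j=1..N. int (maslov_count J (W (t j)) (\<epsilon> j))
                   - int (maslov_count J (W (t (j - 1))) (\<epsilon> j))))"

definition Mas ::
    "('a::real_inner \<Rightarrow> 'a \<Rightarrow> real) \<Rightarrow> ('a \<Rightarrow> 'a) \<Rightarrow> (real \<Rightarrow> 'a set) \<Rightarrow> 'a set \<Rightarrow> int" where
  "Mas \<omega> J \<mu> L = maslov_M J (\<lambda>t. souriau \<omega> J L (\<mu> t))"


section \<open>The space \<open>H \<boxplus> H\<close>\<close>

definition box_form :: "('a \<Rightarrow> 'a \<Rightarrow> real) \<Rightarrow> 'a \<times> 'a \<Rightarrow> 'a \<times> 'a \<Rightarrow> real" where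
  "box_form \<omega> p q = \<omega> (fst p) (fst q) - \<omega> (snd p) (snd q)"

definition box_J :: "('a \<Rightarrow> 'a) \<Rightarrow> 'a \<times> 'a \<Rightarrow> 'a \<times> 'a::real_vector" where
  "box_J J p = (J (fst p), - J (snd p))"

definition diagonal :: "('a \<times> 'a) set" where
  "diagonal = range (\<lambda>x. (x, x))"

lemma symplectic_hilbert_box:
  assumes "symplectic_hilbert \<omega> J"
  shows "symplectic_hilbert (box_form \<omega>) (box_J J)"
proof -
  have b: "bounded_linear J" using assms by (simp add: symplectic_hilbert_def)
  have "bounded_linear (box_J J)"
    unfolding box_J_def
    by (intro bounded_linear_Pair bounded_linear_minus bounded_linear_compose[OF b]
        bounded_linear_fst bounded_linear_snd)
  then show ?thesis
    using assms linear_neg[OF bounded_linear.linear[OF b]]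
    by (auto simp: symplectic_hilbert_def box_form_def box_J_def inner_prod_def)
qed

lemma lagrangian_diagonal:
  assumes "symplectic_hilbert \<omega> J"
  shows "lagrangian (box_form \<omega>) diagonal"
proof -
  have w: "\<omega> x y = J x \<bullet> y" and l: "linear J" and j: "J (J x) = - x" for x y
    using assms by (auto simp: symplectic_hilbert_def bounded_linear.linear)
  have s: "subspace (diagonal :: ('a \<times> 'a) set)"
    by (auto simp: subspace_def diagonal_def zero_prod_def)
  have d: "(diagonal :: ('a \<times> 'a) set) = {p. fst p = snd p}"
    by (auto simp: diagonal_def image_iff)
  have c: "closed (diagonal :: ('a \<times> 'a) set)"
    unfolding d by (intro closed_Collect_eq continuous_intros)
  have "a = b" if "\<forall>z. J a \<bullet> z - J b \<bullet> z = 0" for a b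
  proof -
    have "J a = J b" using that by (simp add: vector_eq_rdot)
    then have "- a = - b" using j by metis
    then show ?thesis by simp
  qed
  then have "{x. \<forall>y\<in>diagonal. box_form \<omega> x y = 0} = diagonal"
    by (auto simp: diagonal_def box_form_def w)
  with s c show ?thesis by (simp add: lagrangian_def)
qed

end

theory Submission
  imports Defs "HOL-Computational_Algebra.Fundamental_Theorem_Algebra"
begin

text \<open>
  Let \<open>\<tau>\<close> and \<open>\<sigma>\<close> be the orthogonal reflections in the Lagrangian subspaces \<open>L\<close> and \<open>M\<close>.  They are
  antilinear for the complex structure \<open>J\<close>, and the Souriau operator of \<open>M\<close> relative to \<open>L\<close> is
  \<open>W = - \<sigma> \<tau>\<close> (\<open>souriau_eq_reflections\<close>).  In the doubled space the reflection in the diagonal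
  swaps the two components and the reflection in \<open>M \<times> L\<close> is \<open>(\<sigma>, \<tau>)\<close>, so the Souriau operator there is
  \<open>W\<^sub>2 (x, y) = (- \<sigma> y, - \<tau> x)\<close>.  For \<open>z\<close> on the unit circle, elimination of one component identifies
  the eigenspace of \<open>W\<^sub>2\<close> at \<open>z\<close> with that of \<open>W\<close> at \<open>- z\<^sup>2\<close>, and \<open>W\<^sub>2 - z\<close> is invertible exactly when
  \<open>W + z\<^sup>2\<close> is.  Since \<open>z = cis (pi + \<theta>)\<close> has \<open>- z\<^sup>2 = cis (pi + 2 * \<theta>)\<close>, the spectral picture of \<open>W\<^sub>2\<close>
  near \<open>- 1\<close> is that of \<open>W\<close> with all angles halved (\<open>arc_admissible_box_iff\<close>, \<open>maslov_count_box\<close>).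

  The Maslov index is the value common to all sums over partitions, so it suffices that the same
  values arise for both paths.  A partition for \<open>W\<close> with angles \<open>\<epsilon>\<close> is one for \<open>W\<^sub>2\<close> with angles
  \<open>\<epsilon> / 2\<close>, and it has the same sum.  Conversely, a partition for \<open>W\<^sub>2\<close> may use angles of \<open>pi / 2\<close> or
  more, which double to angles beyond the range allowed for \<open>W\<close>.  In that case the arc covers the
  circle, the whole spectrum of \<open>W\<close> consists of finitely many eigenvalues of finite multiplicity,
  and \<open>W\<close> is diagonalizable on a finite-dimensional space
  (\<open>finitely_diagonal_if_finite_spectrum\<close>).  The number of eigenvalues on one side of a line is then
  locally constant (\<open>mult_sum_half_plane_eq\<close>), which permits to subdivide the interval and to use
  shorter arcs without changing the sum (\<open>long_arc_chain\<close>).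

  The formula for the Souriau operator requires a unitary operator that carries the orthogonal
  complement of \<open>L\<close> onto \<open>M\<close>.  It is the unitary factor of a polar decomposition
  (\<open>intertwining_unitary_exists\<close>).
\<close>

section \<open>Orthogonal projections and reflections in a Hilbert space\<close>

text \<open>A minimizing sequence for the distance to \<open>S\<close> is Cauchy by the parallelogram identity; its
  limit is the foot of the perpendicular.\<close>

lemma orthogonal_projection_exists:
  fixes S :: "'a::{real_inner, complete_space} set"
  assumes S: "subspace S" and cl: "closed S"
  shows "\<exists>p\<in>S. \<forall>y\<in>S. (x - p) \<bullet> y = 0"
proof -
  define D where "D = (\<lambda>y. (norm (x - y))\<^sup>2) ` S"
  define d where "d = Inf D"
  have ne: "D \<noteq> {}" using subspace_0[OF S] by (auto simp: D_def)
  have bd: "bdd_below D" unfolding D_def by (rule bdd_belowI[of _ 0]) auto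
  have low: "d \<le> (norm (x - y))\<^sup>2" if "y \<in> S" for y
    unfolding d_def using that bd by (auto intro!: cInf_lower simp: D_def)
  have "\<exists>y\<in>S. (norm (x - y))\<^sup>2 < d + 1 / real (Suc n)" for n
    using cInf_lessD[OF ne, of "d + 1 / real (Suc n)"] unfolding d_def[symmetric]
    by (auto simp: D_def)
  then obtain p where pS: "\<And>n. p n \<in> S" and p: "\<And>n. (norm (x - p n))\<^sup>2 < d + 1 / real (Suc n)"
    by metis
  have mid: "(norm (p m - p n))\<^sup>2 \<le> 2 / real (Suc m) + 2 / real (Suc n)" for m n
  proof -
    have "(1/2) *\<^sub>R (p m + p n) \<in> S"
      using S pS by (simp add: subspace_add subspace_scale)
    then have "d \<le> (norm (x - (1/2) *\<^sub>R (p m + p n)))\<^sup>2" by (rule low)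
    moreover have "(norm (p m - p n))\<^sup>2 = 2 * (norm (x - p m))\<^sup>2 + 2 * (norm (x - p n))\<^sup>2
        - 4 * (norm (x - (1/2) *\<^sub>R (p m + p n)))\<^sup>2"
      by (simp add: power2_norm_eq_inner inner_diff_left inner_diff_right inner_add_left
          inner_add_right inner_commute field_simps)
    moreover have "A \<le> 2 * (u + v)"
      if "d \<le> c" "A = 2 * a + 2 * b - 4 * c" "a < d + u" "b < d + v" for A a b c u v :: real
      using that by (simp add: algebra_simps)
    ultimately show ?thesis using p[of m] p[of n] by fastforce
  qed
  have "Cauchy p"
  proof (rule metric_CauchyI)
    fix e :: real assume e: "0 < e"
    obtain M where M: "4 / e\<^sup>2 < real M" using reals_Archimedean2 by blast
    show "\<exists>M. \<forall>m\<ge>M. \<forall>n\<ge>M. dist (p m) (p n) < e"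
    proof (intro exI allI impI)
      fix m n assume "M \<le> m" "M \<le> n"
      have M0: "0 < real M" using M e by (smt (verit) divide_pos_pos zero_less_power)
      have "2 / real (Suc m) < 2 / real M" "2 / real (Suc n) < 2 / real M"
        using \<open>M \<le> m\<close> \<open>M \<le> n\<close> M0 by (auto intro!: divide_strict_left_mono)
      then have "(norm (p m - p n))\<^sup>2 < 4 / real M" using mid[of m n] by simp
      also have "\<dots> < e\<^sup>2" using M M0 e by (simp add: field_simps)
      finally show "dist (p m) (p n) < e"
        using e by (simp add: dist_norm power_less_imp_less_base)
    qed
  qed
  then obtain q where q: "p \<longlonglongrightarrow> q" using Cauchy_convergent convergent_def by blast
  have qS: "q \<in> S" using closed_sequentially[OF cl pS q] .
  have "(\<lambda>n. (norm (x - p n))\<^sup>2) \<longlonglongrightarrow> (norm (x - q))\<^sup>2"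
    by (intro tendsto_intros q)
  moreover have "(\<lambda>n. d + 1 / real (Suc n)) \<longlonglongrightarrow> d + 0"
    by (intro tendsto_intros) (rule LIMSEQ_Suc[OF lim_1_over_n])
  ultimately have qd: "(norm (x - q))\<^sup>2 \<le> d"
    using p by (intro LIMSEQ_le[of "\<lambda>n. (norm (x - p n))\<^sup>2" _ "\<lambda>n. d + 1 / real (Suc n)"])
      (auto intro: less_imp_le)
  have "(x - q) \<bullet> y = 0" if "y \<in> S" for y
  proof (cases "y = 0")
    case False
    define t where "t = ((x - q) \<bullet> y) / (y \<bullet> y)"
    have yy: "y \<bullet> y > 0" using False by simp
    have "q + t *\<^sub>R y \<in> S" using S qS that by (simp add: subspace_add subspace_scale)
    then have "(norm (x - q))\<^sup>2 \<le> (norm (x - q - t *\<^sub>R y))\<^sup>2"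
      using low[of "q + t *\<^sub>R y"] qd unfolding diff_diff_eq by linarith
    also have "\<dots> = (norm (x - q))\<^sup>2 - 2 * t * ((x - q) \<bullet> y) + t * t * (y \<bullet> y)"
      by (simp add: power2_norm_eq_inner inner_diff_left inner_diff_right inner_commute algebra_simps)
    also have "\<dots> = (norm (x - q))\<^sup>2 - ((x - q) \<bullet> y)\<^sup>2 / (y \<bullet> y)"
      using yy by (simp add: t_def field_simps power2_eq_square)
    finally have "((x - q) \<bullet> y)\<^sup>2 / (y \<bullet> y) \<le> 0" by simp
    then show ?thesis using yy by (simp add: divide_le_0_iff)
  qed simp
  then show ?thesis using qS by blast
qed

lemma orth_proj_unique:
  fixes S :: "'a::{real_inner, complete_space} set"
  assumes S: "subspace S" and "p \<in> S" "\<And>y. y \<in> S \<Longrightarrow> (x - p) \<bullet> y = 0"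
  shows "orth_proj S x = p"
  unfolding orth_proj_def
proof (rule the_equality)
  show "p \<in> S \<and> (\<forall>y\<in>S. orthogonal (x - p) y)" using assms by (simp add: orthogonal_def)
  fix q assume q: "q \<in> S \<and> (\<forall>y\<in>S. orthogonal (x - q) y)"
  have "q - p \<in> S" using q assms by (simp add: subspace_diff)
  then have "(x - q) \<bullet> (q - p) = 0" "(x - p) \<bullet> (q - p) = 0"
    using q assms by (auto simp: orthogonal_def)
  then have "(q - p) \<bullet> (q - p) = 0" by (simp add: inner_diff_left)
  then show "q = p" by simp
qed

text \<open>Working with the symmetry that fixes \<open>S\<close> and negates its complement, rather than with the
  projection, makes the Souriau operator a product of isometries.\<close>

definition reflection :: "'a::real_inner set \<Rightarrow> 'a \<Rightarrow> 'a" where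
  "reflection S x = 2 *\<^sub>R orth_proj S x - x"

locale closed_subspace =
  fixes S :: "'a::{real_inner, complete_space} set"
  assumes subspace: "subspace S" and closed: "closed S"
begin

lemma orth_proj_in: "orth_proj S x \<in> S"
  and orth_proj_orthogonal: "y \<in> S \<Longrightarrow> (x - orth_proj S x) \<bullet> y = 0"
  using orthogonal_projection_exists[OF subspace closed, of x]
    orth_proj_unique[OF subspace] by metis+

lemma reflection_eq:
  assumes "p \<in> S" "\<And>y. y \<in> S \<Longrightarrow> q \<bullet> y = 0"
  shows "reflection S (p + q) = p - q"
  using orth_proj_unique[OF subspace, of p "p + q"] assms
  by (simp add: reflection_def algebra_simps scaleR_2)

lemma decompose:
  obtains p q where "x = p + q" "p \<in> S" "\<And>y. y \<in> S \<Longrightarrow> q \<bullet> y = 0"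
proof (rule that[of "orth_proj S x" "x - orth_proj S x"])
  show "x = orth_proj S x + (x - orth_proj S x)" by simp
qed (use orth_proj_in orth_proj_orthogonal in auto)

lemma reflection_fixes: "p \<in> S \<Longrightarrow> reflection S p = p"
  using reflection_eq[of p 0] by simp

lemma reflection_negates: "(\<And>y. y \<in> S \<Longrightarrow> q \<bullet> y = 0) \<Longrightarrow> reflection S q = - q"
  using reflection_eq[of 0 q] subspace_0[OF subspace] by simp

lemma linear_reflection: "linear (reflection S)"
proof
  fix x y :: 'a and c :: real
  obtain p q where x: "x = p + q" "p \<in> S" "\<And>y. y \<in> S \<Longrightarrow> q \<bullet> y = 0"
    using decompose[of x] by metis
  obtain p' q' where y: "y = p' + q'" "p' \<in> S" "\<And>y. y \<in> S \<Longrightarrow> q' \<bullet> y = 0"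
    using decompose[of y] by metis
  have "reflection S ((p + p') + (q + q')) = (p + p') - (q + q')"
    using x y subspace by (intro reflection_eq) (auto simp: subspace_add inner_add_left)
  moreover have "x + y = (p + p') + (q + q')" using x y by simp
  ultimately show "reflection S (x + y) = reflection S x + reflection S y"
    using reflection_eq[OF x(2,3)] reflection_eq[OF y(2,3)] by (simp add: x(1)[symmetric] y(1)[symmetric])
  have "reflection S (c *\<^sub>R p + c *\<^sub>R q) = c *\<^sub>R p - c *\<^sub>R q"
    using x subspace by (intro reflection_eq) (auto simp: subspace_scale)
  moreover have "c *\<^sub>R x = c *\<^sub>R p + c *\<^sub>R q" using x by (simp add: scaleR_add_right)
  ultimately show "reflection S (c *\<^sub>R x) = c *\<^sub>R reflection S x"
    using reflection_eq[OF x(2,3)] by (simp add: x(1)[symmetric] scaleR_diff_right)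
qed

lemma reflection_involution: "reflection S (reflection S x) = x"
proof -
  obtain p q where x: "x = p + q" "p \<in> S" "\<And>y. y \<in> S \<Longrightarrow> q \<bullet> y = 0"
    using decompose[of x] by metis
  then show ?thesis using reflection_eq[of p q] reflection_eq[of p "- q"] by simp
qed

lemma norm_reflection: "norm (reflection S x) = norm x"
proof -
  obtain p q where x: "x = p + q" "p \<in> S" "\<And>y. y \<in> S \<Longrightarrow> q \<bullet> y = 0"
    using decompose[of x] by metis
  have "p \<bullet> q = 0" "q \<bullet> p = 0" using x by (auto simp: inner_commute)
  then have "(p - q) \<bullet> (p - q) = (p + q) \<bullet> (p + q)"
    by (simp add: inner_diff_left inner_diff_right inner_add_left inner_add_right)
  then show ?thesis using reflection_eq[of p q] x by (simp add: norm_eq_sqrt_inner)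
qed

lemma bounded_linear_reflection: "bounded_linear (reflection S)"
  by (rule bounded_linear_intro[of _ 1])
    (auto simp: linear_add[OF linear_reflection] linear_scale[OF linear_reflection] norm_reflection)

lemma reflection_selfadjoint: "reflection S x \<bullet> y = x \<bullet> reflection S y"
proof -
  obtain p q where x: "x = p + q" "p \<in> S" "\<And>y. y \<in> S \<Longrightarrow> q \<bullet> y = 0"
    using decompose[of x] by metis
  obtain p' q' where y: "y = p' + q'" "p' \<in> S" "\<And>y. y \<in> S \<Longrightarrow> q' \<bullet> y = 0"
    using decompose[of y] by metis
  have "p \<bullet> q' = 0" "q \<bullet> p' = 0" using x y by (auto simp: inner_commute)
  then show ?thesis using reflection_eq[of p q] reflection_eq[of p' q'] x y
    by (simp add: inner_diff_left inner_diff_right inner_add_left inner_add_right)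
qed

lemma reflection_eq_self_iff: "reflection S x = x \<longleftrightarrow> x \<in> S"
proof
  assume "reflection S x = x"
  then have "orth_proj S x = x" by (simp add: reflection_def scaleR_2 algebra_simps flip: scaleR_2)
  then show "x \<in> S" using orth_proj_in by metis
qed (rule reflection_fixes)

lemma reflection_eq_minus_iff: "reflection S x = - x \<longleftrightarrow> (\<forall>y\<in>S. x \<bullet> y = 0)"
proof
  assume r: "reflection S x = - x"
  show "\<forall>y\<in>S. x \<bullet> y = 0"
  proof
    fix y assume "y \<in> S"
    then have "x \<bullet> y = - (x \<bullet> y)"
      using reflection_selfadjoint[of x y] r by (simp add: reflection_fixes)
    then show "x \<bullet> y = 0" by simp
  qed
qed (use reflection_negates in blast)

lemma orth_proj_reflection: "orth_proj S x = (1/2) *\<^sub>R (x + reflection S x)"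
  by (simp add: reflection_def)

lemma bounded_linear_orth_proj: "bounded_linear (orth_proj S)"
  unfolding orth_proj_reflection
  by (intro bounded_linear_intros bounded_linear_reflection)

text \<open>The hypotheses say that \<open>V\<close> preserves the splitting into \<open>S\<close> and its orthogonal complement.\<close>

lemma reflection_commute:
  assumes V: "linear V" and "\<And>x. x \<in> S \<Longrightarrow> V x \<in> S"
    and "\<And>x y. (\<And>z. z \<in> S \<Longrightarrow> x \<bullet> z = 0) \<Longrightarrow> y \<in> S \<Longrightarrow> V x \<bullet> y = 0"
  shows "reflection S (V x) = V (reflection S x)"
proof -
  obtain p q where x: "x = p + q" "p \<in> S" "\<And>y. y \<in> S \<Longrightarrow> q \<bullet> y = 0"
    using decompose[of x] by metis
  have "reflection S (V p + V q) = V p - V q"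
    using x assms by (intro reflection_eq) blast+
  then show ?thesis using reflection_eq[of p q] x
    by (simp add: linear_add[OF V] linear_diff[OF V])
qed

end

lemma subspace_closure:
  fixes S :: "'a::real_normed_vector set"
  assumes S: "subspace S"
  shows "subspace (closure S)"
proof (rule subspaceI)
  show "0 \<in> closure S" using subspace_0[OF S] closure_subset by blast
next
  fix x y assume "x \<in> closure S" "y \<in> closure S"
  then obtain f g where "\<And>n. f n \<in> S" "f \<longlonglongrightarrow> x" "\<And>n. g n \<in> S" "g \<longlonglongrightarrow> y"
    unfolding closure_sequential by metis
  then have "\<And>n. f n + g n \<in> S" "(\<lambda>n. f n + g n) \<longlonglongrightarrow> x + y"
    by (auto intro: subspace_add[OF S] tendsto_add)
  then show "x + y \<in> closure S" unfolding closure_sequential by (intro exI[of _ "\<lambda>n. f n + g n"]) auto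
next
  fix c x assume "x \<in> closure S"
  then obtain f where "\<And>n. f n \<in> S" "f \<longlonglongrightarrow> x" unfolding closure_sequential by metis
  then have "\<And>n. c *\<^sub>R f n \<in> S" "(\<lambda>n. c *\<^sub>R f n) \<longlonglongrightarrow> c *\<^sub>R x"
    by (auto intro: subspace_scale[OF S] tendsto_scaleR)
  then show "c *\<^sub>R x \<in> closure S" unfolding closure_sequential by (intro exI[of _ "\<lambda>n. c *\<^sub>R f n"]) auto
qed

lemma dense_if_orthogonal_trivial:
  fixes S :: "'a::{real_inner, complete_space} set"
  assumes S: "subspace S" and o: "\<And>y. (\<And>x. x \<in> S \<Longrightarrow> x \<bullet> y = 0) \<Longrightarrow> y = 0"
  shows "closure S = UNIV"
proof -
  have "x \<in> closure S" for x
  proof -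
    obtain p where p: "p \<in> closure S" "\<And>y. y \<in> closure S \<Longrightarrow> (x - p) \<bullet> y = 0"
      using orthogonal_projection_exists[OF subspace_closure[OF S] closed_closure, of x] by metis
    have "x - p = 0" using p(2) closure_subset[of S] by (intro o) (auto simp: inner_commute)
    then show ?thesis using p by simp
  qed
  then show ?thesis by auto
qed

section \<open>Square roots and polar decomposition\<close>

text \<open>The square root of \<open>1 - B\<close> is \<open>1 - Z\<close>, where \<open>Z\<close> is the fixed point of
  \<open>Z \<mapsto> (B + Z\<^sup>2) / 2\<close> reached from \<open>0\<close>.  The iterates and their increments are bounded by those of
  the scalar recursion \<open>y \<mapsto> (1 + y\<^sup>2) / 2\<close>, which increases to \<open>1\<close>; this gives convergence also in
  the borderline case that \<open>B\<close> has norm \<open>1\<close>.  Every iterate is a polynomial in \<open>B\<close>, so the limit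
  commutes with whatever commutes with \<open>B\<close>.\<close>

lemma sqrt_one_minus:
  fixes B :: "'a::{real_inner, complete_space} \<Rightarrow> 'a"
  assumes B: "linear B" and nB: "\<And>x. norm (B x) \<le> norm x" and sa: "\<And>x y. B x \<bullet> y = x \<bullet> B y"
  obtains R :: "'a \<Rightarrow> 'a" where "linear R" "\<And>x. R (R x) = x - B x" "\<And>x y. R x \<bullet> y = x \<bullet> R y"
    "\<And>V x. bounded_linear V \<Longrightarrow> (\<And>x. V (B x) = B (V x)) \<Longrightarrow> V (R x) = R (V x)"
proof -
  define Y where "Y = rec_nat (\<lambda>_. 0) (\<lambda>_ Z x. (1/2) *\<^sub>R (B x + Z (Z x)))"
  define y where "y = rec_nat (0 :: real) (\<lambda>_ z. (1 + z * z) / 2)"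
  have Y0: "Y 0 x = 0" and YS: "Y (Suc n) x = (1/2) *\<^sub>R (B x + Y n (Y n x))" for n x
    by (auto simp: Y_def)
  have y0: "y 0 = 0" and yS: "\<And>n. y (Suc n) = (1 + y n * y n) / 2"
    by (auto simp: y_def)
  have y01: "0 \<le> y n \<and> y n \<le> 1" for n
  proof (induction n)
    case (Suc n)
    then have "y n * y n \<le> 1 * 1" by (intro mult_mono) auto
    then show ?case by (simp add: yS)
  qed (simp add: y0)
  have yinc: "y n \<le> y (Suc n)" for n
    using zero_le_square[of "1 - y n"] by (simp add: yS algebra_simps)
  have linY: "linear (Y n)" for n
  proof (induction n)
    case 0
    have "Y 0 = (\<lambda>_. 0)" by (simp add: fun_eq_iff Y0)
    then show ?case using module_hom_zero by metis
  next
    case (Suc n)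
    show ?case
      by (rule linearI)
        (simp_all add: YS linear_add[OF B] linear_scale[OF B] linear_add[OF Suc] linear_scale[OF Suc] algebra_simps)
  qed
  have Yy: "norm (Y n x) \<le> y n * norm x" for n x
  proof (induction n arbitrary: x)
    case (Suc n)
    have "norm (Y n (Y n x)) \<le> y n * (y n * norm x)"
      using Suc[of x] Suc[of "Y n x"] y01[of n] by (meson mult_left_mono order_trans)
    then have "norm (B x + Y n (Y n x)) \<le> norm x + y n * (y n * norm x)"
      using nB[of x] norm_triangle_ineq[of "B x" "Y n (Y n x)"] by linarith
    then show ?case by (simp add: YS yS algebra_simps del: scaleR_add_right)
  qed (simp add: Y0 y0)
  have Y1: "norm (Y n x) \<le> norm x" for n x
    using Yy[of n x] y01[of n] by (meson mult_left_le_one_le norm_ge_zero order_trans)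
  have step: "norm (Y (Suc n) x - Y n x) \<le> (y (Suc n) - y n) * norm x" for n x
  proof (induction n arbitrary: x)
    case 0
    show ?case using nB[of x] by (simp add: YS yS Y0 y0)
  next
    case (Suc n)
    let ?D = "\<lambda>x. Y (Suc n) x - Y n x"
    have "Y (Suc (Suc n)) x - Y (Suc n) x
        = (1/2) *\<^sub>R (B x + Y (Suc n) (Y (Suc n) x)) - (1/2) *\<^sub>R (B x + Y n (Y n x))"
      by (simp only: YS[of "Suc n" x, symmetric] YS[of n x, symmetric])
    also have "\<dots> = (1/2) *\<^sub>R (Y (Suc n) (?D x) + ?D (Y n x))"
      by (simp add: linear_diff[OF linY] algebra_simps)
    finally have eq: "Y (Suc (Suc n)) x - Y (Suc n) x = (1/2) *\<^sub>R (Y (Suc n) (?D x) + ?D (Y n x))" .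
    have "norm (Y (Suc n) (?D x)) \<le> y (Suc n) * ((y (Suc n) - y n) * norm x)"
      using Yy[of "Suc n" "?D x"] Suc[of x] y01[of "Suc n"] by (meson mult_left_mono order_trans)
    moreover have "norm (?D (Y n x)) \<le> (y (Suc n) - y n) * (y n * norm x)"
      using Suc[of "Y n x"] Yy[of n x] yinc[of n] by (smt (verit) mult_left_mono)
    ultimately have "norm (Y (Suc (Suc n)) x - Y (Suc n) x)
        \<le> (1/2) * (y (Suc n) * ((y (Suc n) - y n) * norm x) + (y (Suc n) - y n) * (y n * norm x))"
      using norm_triangle_ineq[of "Y (Suc n) (?D x)" "?D (Y n x)"] unfolding eq by simp
    also have "\<dots> = (y (Suc (Suc n)) - y (Suc n)) * norm x"
    proof -
      have "(1/2) * (a * ((a - b) * d) + (a - b) * (b * d)) = (c - a) * d"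
        if "a = (1 + b * b) / 2" "c = (1 + a * a) / 2" for a b c d :: real
      proof -
        have ca: "c - a = (a * a - b * b) / 2" by (simp add: that(2)) (simp add: that(1) diff_divide_distrib add_divide_distrib)
        show ?thesis unfolding ca by (simp add: field_simps)
      qed
      from this[OF yS yS] show ?thesis .
    qed
    finally show ?case .
  qed
  have far: "norm (Y (n + k) x - Y n x) \<le> (y (n + k) - y n) * norm x" for n k x
  proof (induction k)
    case (Suc k)
    then show ?case
      using step[of "n + k" x] norm_triangle_ineq[of "Y (Suc (n + k)) x - Y (n + k) x" "Y (n + k) x - Y n x"]
      by (simp add: algebra_simps)
  qed simp
  have "incseq y" using yinc by (rule incseq_SucI)
  moreover have "bdd_above (range y)" using y01 by (intro bdd_aboveI[of _ 1]) auto
  ultimately have "convergent y"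
    using LIMSEQ_incseq_SUP by (auto simp: convergent_def)
  then have Cy: "Cauchy y" by (rule convergent_Cauchy)
  have "Cauchy (\<lambda>n. Y n x)" for x
  proof (rule metric_CauchyI)
    fix e :: real assume "0 < e"
    then have "0 < e / (norm x + 1)" by (simp add: add_nonneg_pos)
    then obtain M where M: "\<And>m n. m \<ge> M \<Longrightarrow> n \<ge> M \<Longrightarrow> dist (y m) (y n) < e / (norm x + 1)"
      using metric_CauchyD[OF Cy] by meson
    have *: "dist (Y m x) (Y (m + k) x) < e" if "M \<le> m" for m k
    proof -
      have "\<bar>y (m + k) - y m\<bar> < e / (norm x + 1)"
        using M[of m "m + k"] that by (simp add: dist_real_def abs_minus_commute)
      then have "\<bar>y (m + k) - y m\<bar> * (norm x + 1) < e"
        by (simp add: pos_less_divide_eq add_nonneg_pos)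
      moreover have "(y (m + k) - y m) * norm x \<le> \<bar>y (m + k) - y m\<bar> * (norm x + 1)"
        by (intro mult_mono abs_ge_self) simp_all
      ultimately show ?thesis
        using far[of m k x] by (simp add: dist_norm norm_minus_commute)
    qed
    show "\<exists>M. \<forall>m\<ge>M. \<forall>n\<ge>M. dist (Y m x) (Y n x) < e"
    proof (intro exI allI impI)
      fix m n :: nat assume "M \<le> m" "M \<le> n"
      then show "dist (Y m x) (Y n x) < e"
        using *[of m "n - m"] *[of n "m - n"] by (cases "m \<le> n") (simp_all add: dist_commute)
    qed
  qed
  then have "\<forall>x. \<exists>z. (\<lambda>n. Y n x) \<longlonglongrightarrow> z" using Cauchy_convergent convergent_def by metis
  then obtain Z where Z: "\<And>x. (\<lambda>n. Y n x) \<longlonglongrightarrow> Z x" by metis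
  have linZ: "linear Z"
  proof (rule linearI)
    show "Z (u + v) = Z u + Z v" for u v
      using LIMSEQ_unique[OF Z tendsto_add[OF Z Z, of u v, folded linear_add[OF linY]]] .
    show "Z (c *\<^sub>R u) = c *\<^sub>R Z u" for c u
      using LIMSEQ_unique[OF Z tendsto_scaleR[OF tendsto_const Z, of c u, folded linear_scale[OF linY]]] .
  qed
  have ZZ: "(\<lambda>n. Y n (Y n x)) \<longlonglongrightarrow> Z (Z x)" for x
  proof (rule Lim_transform2[OF Z[of "Z x"]])
    have lim: "(\<lambda>n. norm (Y n x - Z x)) \<longlonglongrightarrow> 0" by (intro tendsto_norm_zero LIM_zero Z)
    have "norm (Y n (Z x) - Y n (Y n x)) \<le> norm (Y n x - Z x)" for n
      using Y1[of n "Z x - Y n x"] by (simp add: linear_diff[OF linY] norm_minus_commute)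
    then show "(\<lambda>n. Y n (Z x) - Y n (Y n x)) \<longlonglongrightarrow> 0"
      by (intro Lim_null_comparison[OF always_eventually lim] allI)
  qed
  have fix_eq: "Z x = (1/2) *\<^sub>R (B x + Z (Z x))" for x
  proof (rule LIMSEQ_unique[OF LIMSEQ_Suc[OF Z]])
    show "(\<lambda>n. Y (Suc n) x) \<longlonglongrightarrow> (1/2) *\<^sub>R (B x + Z (Z x))"
      unfolding YS by (intro tendsto_scaleR tendsto_add tendsto_const ZZ)
  qed
  have saY: "Y n x \<bullet> z = x \<bullet> Y n z" for n x z
  proof (induction n arbitrary: x z)
    case (Suc n)
    then show ?case
      by (simp add: YS inner_add_left inner_add_right sa)
  qed (simp add: Y0)
  have saZ: "Z x \<bullet> z = x \<bullet> Z z" for x z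
    using LIMSEQ_unique[OF tendsto_inner[OF Z[of x] tendsto_const[of z]], of "x \<bullet> Z z"]
      tendsto_inner[OF tendsto_const[of x] Z[of z]] by (simp add: saY)
  have comm: "V (Z x) = Z (V x)" if V: "bounded_linear V" and VB: "\<And>x. V (B x) = B (V x)" for V x
  proof -
    have VY: "V (Y n x) = Y n (V x)" for n x
    proof (induction n arbitrary: x)
      case (Suc n)
      then show ?case using VB
        by (simp add: YS linear_add[OF bounded_linear.linear[OF V]]
            linear_scale[OF bounded_linear.linear[OF V]])
    qed (simp add: Y0 linear_0[OF bounded_linear.linear[OF V]])
    have "(\<lambda>n. V (Y n x)) \<longlonglongrightarrow> V (Z x)" by (rule bounded_linear.tendsto[OF V Z])
    then have "(\<lambda>n. Y n (V x)) \<longlonglongrightarrow> V (Z x)" by (simp only: VY)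
    then show ?thesis using Z by (rule LIMSEQ_unique)
  qed
  show thesis
  proof (rule that[of "\<lambda>x. x - Z x"])
    show "linear (\<lambda>x. x - Z x)"
      by (rule linearI) (simp_all add: linear_add[OF linZ] linear_scale[OF linZ] algebra_simps)
    fix x
    have "Z x + Z x = B x + Z (Z x)"
      using fix_eq[of x] by (metis scaleR_half_double scaleR_right_distrib)
    then show "(x - Z x) - Z (x - Z x) = x - B x"
      by (simp add: linear_diff[OF linZ] algebra_simps)
  next
    fix x y show "(x - Z x) \<bullet> y = x \<bullet> (y - Z y)"
      by (simp add: inner_diff_left inner_diff_right saZ)
  next
    fix V :: "'a \<Rightarrow> 'a" and x assume V: "bounded_linear V" "\<And>x. V (B x) = B (V x)"
    show "V (x - Z x) = V x - Z (V x)"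
      using comm[OF V] by (simp add: linear_diff[OF bounded_linear.linear[OF V(1)]])
  qed
qed

lemma isometric_image_converges:
  fixes R T :: "'a::{real_inner, complete_space} \<Rightarrow> 'a"
  assumes R: "linear R" and T: "linear T" and n: "\<And>x. norm (T x) = norm (R x)"
    and dR: "closure (range R) = UNIV"
  obtains x u where "(\<lambda>k. R (x k)) \<longlonglongrightarrow> y" "(\<lambda>k. T (x k)) \<longlonglongrightarrow> u"
proof -
  have "y \<in> closure (range R)" by (simp add: dR)
  then obtain z where z: "\<And>k. z k \<in> range R" "z \<longlonglongrightarrow> y" unfolding closure_sequential by blast
  then have "\<forall>k. \<exists>x. z k = R x" by blast
  then obtain x where x: "\<And>k. z k = R (x k)" by metis
  have lim: "(\<lambda>k. R (x k)) \<longlonglongrightarrow> y" using z(2) by (simp add: x[symmetric])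
  have "dist (T (x m)) (T (x k)) = dist (R (x m)) (R (x k))" for m k
    using n[of "x m - x k"] by (simp add: dist_norm linear_diff[OF R] linear_diff[OF T])
  then have "Cauchy (\<lambda>k. T (x k))"
    using LIMSEQ_imp_Cauchy[OF lim] by (simp add: Cauchy_def)
  then obtain u where "(\<lambda>k. T (x k)) \<longlonglongrightarrow> u" using Cauchy_convergent convergent_def by blast
  then show thesis using lim that by blast
qed

text \<open>Partial isometry of a polar decomposition: \<open>R x \<mapsto> T x\<close> is an isometry between dense subspaces,
  and the closure of its graph is the graph of an isometry of the whole space.\<close>

lemma isometry_from_dense_ranges:
  fixes R T :: "'a::{real_inner, complete_space} \<Rightarrow> 'a"
  assumes R: "linear R" and T: "linear T" and n: "\<And>x. norm (T x) = norm (R x)"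
    and dR: "closure (range R) = UNIV" and dT: "closure (range T) = UNIV"
  obtains U where "bounded_linear U" "surj U" "\<And>x. norm (U x) = norm x" "\<And>x. U (R x) = T x"
proof -
  define G where "G = closure (range (\<lambda>x. (R x, T x)))"
  have "linear (\<lambda>x. (R x, T x))"
    by (rule linearI) (auto simp: linear_add[OF R] linear_add[OF T] linear_scale[OF R] linear_scale[OF T])
  then have "subspace (range (\<lambda>x. (R x, T x)))" by (intro linear_subspace_image) auto
  then have G: "subspace G" unfolding G_def by (rule subspace_closure)
  have cG: "closed G" unfolding G_def by simp
  have GI: "(R x, T x) \<in> G" for x
    unfolding G_def using closure_subset by fastforce
  have "G \<subseteq> {g. norm (fst g) = norm (snd g)}"
    unfolding G_def
    by (rule closure_minimal) (auto simp: n intro!: closed_Collect_eq continuous_intros)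
  then have Gn: "norm u = norm y" if "(y, u) \<in> G" for y u using that by auto
  have GL: "(y, u) \<in> G" if "(\<lambda>k. R (x k)) \<longlonglongrightarrow> y" "(\<lambda>k. T (x k)) \<longlonglongrightarrow> u" for x y u
    using closed_sequentially[OF cG, of "\<lambda>k. (R (x k), T (x k))"] GI tendsto_Pair[OF that] by blast
  have "\<exists>u. (y, u) \<in> G" for y
    using isometric_image_converges[OF R T n dR, of y] GL by metis
  moreover have "\<exists>y. (y, u) \<in> G" for u
    using isometric_image_converges[OF T R n[symmetric] dT, of u] GL by metis
  moreover have uniq: "u = v" if "(y, u) \<in> G" "(y, v) \<in> G" for y u v
    using Gn[of 0 "u - v"] subspace_diff[OF G that] by simp
  ultimately obtain U where U: "\<And>y. (y, U y) \<in> G" and sU: "\<And>u. \<exists>y. (y, u) \<in> G" by metis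
  have add: "U (x + y) = U x + U y" for x y
    using uniq[OF U[of "x + y"], of "U x + U y"] subspace_add[OF G U U, of x y] by simp
  have scale: "U (c *\<^sub>R x) = c *\<^sub>R U x" for c x
    using uniq[OF U[of "c *\<^sub>R x"], of "c *\<^sub>R U x"] subspace_scale[OF G U, of c x] by simp
  show thesis
  proof (rule that[of U])
    show "bounded_linear U"
      by (rule bounded_linear_intro[of _ 1]) (auto simp: add scale Gn[OF U])
    show "surj U" using sU uniq U by (metis surjI)
    show "norm (U x) = norm x" for x by (rule Gn[OF U])
    show "U (R x) = T x" for x using uniq[OF U GI] .
  qed
qed

section \<open>The Souriau map in terms of reflections\<close>

locale symplectic_space =
  fixes \<omega> :: "'a::{real_inner, complete_space} \<Rightarrow> 'a \<Rightarrow> real" and J :: "'a \<Rightarrow> 'a"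
  assumes symplectic: "symplectic_hilbert \<omega> J"
begin

lemma bounded_linear_J: "bounded_linear J"
  and omega_eq: "\<omega> x y = J x \<bullet> y"
  and J_J: "J (J x) = - x"
  and J_inner: "J x \<bullet> y = - (x \<bullet> J y)"
  using symplectic unfolding symplectic_hilbert_def by auto

lemma linear_J: "linear J"
  using bounded_linear_J by (rule bounded_linear.linear)

lemmas J_simps = linear_0[OF linear_J] linear_add[OF linear_J] linear_diff[OF linear_J]
  linear_neg[OF linear_J] linear_scale[OF linear_J] J_J

lemma J_inner_J: "J x \<bullet> J y = x \<bullet> y"
  by (simp add: J_inner J_J)

end

locale lagrangian_subspace = symplectic_space +
  fixes L
  assumes lagrangian: "lagrangian \<omega> L"

sublocale lagrangian_subspace \<subseteq> closed_subspace L
  using lagrangian by unfold_locales (auto simp: lagrangian_def)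

context lagrangian_subspace
begin

text \<open>For the compatible inner product, the orthogonal complement of a Lagrangian subspace \<open>L\<close> is \<open>J L\<close>.
  This is what makes the reflection in \<open>L\<close> antilinear.\<close>

lemma orthogonal_iff_J_in: "(\<forall>y\<in>L. x \<bullet> y = 0) \<longleftrightarrow> J x \<in> L"
proof -
  have "J x \<in> L \<longleftrightarrow> (\<forall>y\<in>L. \<omega> (J x) y = 0)"
    using lagrangian by (auto simp: lagrangian_def)
  then show ?thesis by (simp add: omega_eq J_J)
qed

lemma J_orthogonal: "x \<in> L \<Longrightarrow> y \<in> L \<Longrightarrow> J x \<bullet> y = 0"
  using orthogonal_iff_J_in[of "J x"] subspace_neg[OF subspace] by (auto simp: J_J)

lemma reflection_J: "reflection L (J x) = - J (reflection L x)"
proof -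
  obtain p q where x: "x = p + q" "p \<in> L" "\<And>y. y \<in> L \<Longrightarrow> q \<bullet> y = 0"
    using decompose[of x] by metis
  have "J q \<in> L" using x orthogonal_iff_J_in by blast
  then have "reflection L (J q + J p) = J q - J p"
    using x J_orthogonal by (intro reflection_eq) auto
  moreover have "J x = J q + J p" by (simp add: x(1) J_simps)
  moreover have "reflection L x = p - q" unfolding x(1) by (rule reflection_eq[OF x(2,3)])
  ultimately show ?thesis by (simp add: J_simps)
qed

lemma lagr_conj_eq_reflection: "lagr_conj J L = reflection L"
proof
  fix z
  obtain p q where z: "z = p + q" "p \<in> L" "\<And>y. y \<in> L \<Longrightarrow> q \<bullet> y = 0"
    using decompose[of z] by metis
  have r: "reflection L (x + J y) = x - J y" if "x \<in> L" "y \<in> L" for x y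
    using that J_orthogonal by (intro reflection_eq) auto
  have q: "- J q \<in> L" using z orthogonal_iff_J_in subspace_neg[OF subspace] by blast
  show "lagr_conj J L z = reflection L z"
    unfolding lagr_conj_def
  proof (rule the_equality)
    show "\<exists>x\<in>L. \<exists>y\<in>L. z = x + J y \<and> reflection L z = x - J y"
      using z q r[OF z(2) q] by (intro bexI[of _ p] bexI[of _ "- J q"]) (auto simp: J_simps)
  qed (use r in auto)
qed

lemma orthogonal_comp_eq: "x \<in> L\<^sup>\<bottom> \<longleftrightarrow> (\<forall>y\<in>L. x \<bullet> y = 0)"
  by (simp add: orthogonal_comp_def orthogonal_def inner_commute)

end

lemma linear_isometry_inner:
  fixes U :: "'a::real_inner \<Rightarrow> 'a"
  assumes U: "linear U" and n: "\<And>x. norm (U x) = norm x"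
  shows "U x \<bullet> U y = x \<bullet> y"
  using n[of "x + y"] n[of x] n[of y]
  by (simp add: norm_eq_sqrt_inner linear_add[OF U] inner_add_left inner_add_right inner_commute)

text \<open>A unitary operator with \<open>\<sigma> U = - U \<tau>\<close>, where \<open>\<tau>\<close> and \<open>\<sigma>\<close> are the reflections in \<open>L\<close> and
  \<open>M\<close>, carries the complement of \<open>L\<close> (where \<open>\<tau>\<close> is \<open>- 1\<close>) onto \<open>M\<close> (where \<open>\<sigma>\<close> is \<open>1\<close>).
  With \<open>W = - \<sigma> \<tau>\<close>, the operator \<open>(1 + W) / 2\<close> has this intertwining property but is neither
  unitary nor, on the subspace \<open>F\<close> where \<open>\<tau>\<close> and \<open>\<sigma>\<close> agree and \<open>W\<close> is \<open>- 1\<close>, injective.  On \<open>F\<close>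
  multiplication by \<open>J\<close> has the property, so \<open>T\<close>, the sum of \<open>(1 + W) / 2\<close> and of \<open>J\<close> composed with
  the projection onto \<open>F\<close>, is an injective intertwiner with dense range.  Its absolute value
  commutes with \<open>J\<close> and \<open>\<tau>\<close>, and the partial isometry of its polar decomposition is the unitary
  operator sought.\<close>

lemma intertwining_unitary_exists:
  assumes "symplectic_hilbert \<omega> J" "lagrangian \<omega> L" "lagrangian \<omega> M"
  obtains U where "unitary_op \<omega> J U" "\<And>x. reflection M (U x) = - U (reflection L x)"
proof -
  interpret L: lagrangian_subspace \<omega> J L using assms by unfold_locales
  interpret M: lagrangian_subspace \<omega> J M using assms by unfold_locales
  define \<tau> \<sigma> where "\<tau> = reflection L" and "\<sigma> = reflection M"
  note refl_facts =
    linear_0[OF L.linear_reflection] linear_add[OF L.linear_reflection] linear_diff[OF L.linear_reflection]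
    linear_neg[OF L.linear_reflection] linear_scale[OF L.linear_reflection]
    L.reflection_involution L.reflection_J L.norm_reflection
    linear_0[OF M.linear_reflection] linear_add[OF M.linear_reflection] linear_diff[OF M.linear_reflection]
    linear_neg[OF M.linear_reflection] linear_scale[OF M.linear_reflection]
    M.reflection_involution M.reflection_J M.norm_reflection
  note rs = refl_facts[folded \<tau>_def \<sigma>_def] L.J_simps
  have \<tau>_sa: "\<tau> x \<bullet> y = x \<bullet> \<tau> y" and \<sigma>_sa: "\<sigma> x \<bullet> y = x \<bullet> \<sigma> y" for x y
    unfolding \<tau>_def \<sigma>_def by (rule L.reflection_selfadjoint M.reflection_selfadjoint)+
  have bl: "bounded_linear \<tau>" "bounded_linear \<sigma>"
    unfolding \<tau>_def \<sigma>_def by (rule L.bounded_linear_reflection M.bounded_linear_reflection)+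
  define F where "F = {x. \<tau> x = \<sigma> x}"
  interpret F: closed_subspace F
  proof
    show "subspace F" by (rule subspaceI) (auto simp: F_def rs)
    show "closed F" unfolding F_def
      by (intro closed_Collect_eq linear_continuous_on bl)
  qed
  define \<rho> where "\<rho> = reflection F"
  have F_J: "J x \<in> F" and F_\<tau>: "\<tau> x \<in> F" and F_\<sigma>: "\<sigma> x \<in> F" if "x \<in> F" for x
    using that by (auto simp: F_def rs) (metis rs(6) rs(14))+
  have \<rho>_J: "\<rho> (J x) = J (\<rho> x)" for x
    unfolding \<rho>_def
  proof (rule F.reflection_commute[OF L.linear_J F_J])
    fix x y assume "\<And>z. z \<in> F \<Longrightarrow> x \<bullet> z = 0" "y \<in> F"
    then show "J x \<bullet> y = 0" by (simp add: L.J_inner F_J)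
  qed
  have \<rho>_\<tau>: "\<rho> (\<tau> x) = \<tau> (\<rho> x)" for x
    unfolding \<rho>_def
  proof (rule F.reflection_commute[OF bounded_linear.linear[OF bl(1)] F_\<tau>])
    fix x y assume "\<And>z. z \<in> F \<Longrightarrow> x \<bullet> z = 0" "y \<in> F"
    then show "\<tau> x \<bullet> y = 0" by (simp add: \<tau>_sa F_\<tau>)
  qed
  have \<rho>_\<sigma>: "\<rho> (\<sigma> x) = \<sigma> (\<rho> x)" for x
    unfolding \<rho>_def
  proof (rule F.reflection_commute[OF bounded_linear.linear[OF bl(2)] F_\<sigma>])
    fix x y assume "\<And>z. z \<in> F \<Longrightarrow> x \<bullet> z = 0" "y \<in> F"
    then show "\<sigma> x \<bullet> y = 0" by (simp add: \<sigma>_sa F_\<sigma>)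
  qed
  have lin_\<rho>: "linear \<rho>" and bl_\<rho>: "bounded_linear \<rho>"
    unfolding \<rho>_def by (rule F.linear_reflection F.bounded_linear_reflection)+
  \<comment> \<open>\<open>x + \<rho> x\<close> is twice the projection of \<open>x\<close> onto \<open>F\<close>; \<open>B\<close> is chosen so that \<open>1 - B\<close> is half of
    the adjoint of \<open>T\<close> times \<open>T\<close>, the factor one half making the norm of \<open>B\<close> at most \<open>1\<close>.\<close>
  define T where "T x = (1/2) *\<^sub>R (x - \<sigma> (\<tau> x)) + (1/2) *\<^sub>R J (x + \<rho> x)" for x
  define B where "B x = (1/2) *\<^sub>R x + (1/8) *\<^sub>R (\<sigma> (\<tau> x) + \<tau> (\<sigma> x)) - (1/4) *\<^sub>R \<rho> x" for x
  note ls = rs \<rho>_J \<rho>_\<tau> \<rho>_\<sigma> linear_0[OF lin_\<rho>] linear_add[OF lin_\<rho>] linear_diff[OF lin_\<rho>]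
    linear_neg[OF lin_\<rho>] linear_scale[OF lin_\<rho>]
  have blB: "bounded_linear B" and blT: "bounded_linear T"
    unfolding B_def T_def
    by (intro bounded_linear_intros bounded_linear_compose[OF bl(1)] bounded_linear_compose[OF bl(2)]
       bl bl_\<rho> bounded_linear_compose[OF L.bounded_linear_J])+
  have normB: "norm (B x) \<le> norm x" for x
  proof -
    have "norm (\<rho> x) = norm x" by (simp add: \<rho>_def F.norm_reflection)
    moreover have "norm (B x) \<le> norm ((1/2) *\<^sub>R x) + norm ((1/8) *\<^sub>R (\<sigma> (\<tau> x) + \<tau> (\<sigma> x))) + norm ((1/4) *\<^sub>R \<rho> x)"
      unfolding B_def by (meson norm_triangle_ineq norm_triangle_ineq4 add_right_mono order_trans)
    moreover have "norm (\<sigma> (\<tau> x) + \<tau> (\<sigma> x)) \<le> norm x + norm x"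
      using norm_triangle_ineq[of "\<sigma> (\<tau> x)" "\<tau> (\<sigma> x)"] by (simp add: rs)
    ultimately show ?thesis by simp
  qed
  have saB: "B x \<bullet> y = x \<bullet> B y" for x y
  proof -
    have "\<rho> x \<bullet> y = x \<bullet> \<rho> y" unfolding \<rho>_def by (rule F.reflection_selfadjoint)
    then show ?thesis
      by (simp add: B_def inner_add_left inner_add_right inner_diff_left inner_diff_right \<tau>_sa \<sigma>_sa)
  qed
  obtain R where linR: "linear R" and RR: "\<And>x. R (R x) = x - B x" and saR: "\<And>x y. R x \<bullet> y = x \<bullet> R y"
    and comR: "\<And>V x. bounded_linear V \<Longrightarrow> (\<And>x. V (B x) = B (V x)) \<Longrightarrow> V (R x) = R (V x)"
    using sqrt_one_minus[OF bounded_linear.linear[OF blB] normB saB] by metis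
  have split: "\<exists>P Q. x = P + Q \<and> P \<in> F \<and> (\<forall>z\<in>F. Q \<bullet> z = 0) \<and> \<rho> x = P - Q" for x
    using F.decompose[of x] F.reflection_eq unfolding \<rho>_def by metis
  have onF: "\<sigma> (\<tau> P) = P" "\<tau> (\<sigma> P) = P" if "P \<in> F" for P
    using that by (simp_all add: F_def rs) (metis rs(6))
  have offF: "Q - \<sigma> (\<tau> Q) = 0 \<Longrightarrow> Q = 0" "Q - \<tau> (\<sigma> Q) = 0 \<Longrightarrow> Q = 0" if "\<forall>z\<in>F. Q \<bullet> z = 0" for Q
  proof -
    assume "Q - \<sigma> (\<tau> Q) = 0"
    then have "Q \<in> F" by (simp add: F_def) (metis rs(14))
    then show "Q = 0" using that by auto
  next
    assume "Q - \<tau> (\<sigma> Q) = 0"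
    then have "Q \<in> F" by (simp add: F_def) (metis rs(6))
    then show "Q = 0" using that by auto
  qed
  have T_split: "T (P + Q) = (1/2) *\<^sub>R (Q - \<sigma> (\<tau> Q)) + J P"
    if "P \<in> F" "\<rho> (P + Q) = P - Q" for P Q
    using that by (simp add: T_def rs onF(1))
  have orthF: "\<sigma> (\<tau> Q) \<bullet> z = 0" "\<tau> (\<sigma> Q) \<bullet> z = 0" if "\<forall>z\<in>F. Q \<bullet> z = 0" "z \<in> F" for Q z
    using that by (auto simp: \<sigma>_sa \<tau>_sa F_\<sigma> F_\<tau>)
  have zero_sum: "a = 0 \<and> b = 0" if "a + b = 0" "a \<bullet> b = 0" for a b :: 'a
    using that by (metis add.right_neutral add_0 add_eq_0_iff inner_eq_zero_iff inner_minus_right neg_equal_0_iff_equal)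
  have TB: "(norm (T x))\<^sup>2 = 2 * (norm (R x))\<^sup>2" for x
  proof -
    obtain P Q where x: "x = P + Q" "P \<in> F" "\<forall>z\<in>F. Q \<bullet> z = 0" "\<rho> x = P - Q" using split by metis
    have o: "Q \<bullet> P = 0" "P \<bullet> Q = 0" "\<sigma> (\<tau> Q) \<bullet> J P = 0" "J P \<bullet> \<sigma> (\<tau> Q) = 0"
      "Q \<bullet> J P = 0" "J P \<bullet> Q = 0" "\<sigma> (\<tau> Q) \<bullet> P = 0" "\<tau> (\<sigma> Q) \<bullet> P = 0"
      using x orthF F_J by (auto simp: inner_commute)
    have i: "\<sigma> (\<tau> Q) \<bullet> \<sigma> (\<tau> Q) = Q \<bullet> Q" "\<tau> (\<sigma> Q) \<bullet> Q = \<sigma> (\<tau> Q) \<bullet> Q" "Q \<bullet> \<sigma> (\<tau> Q) = \<sigma> (\<tau> Q) \<bullet> Q"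
      by (simp add: \<sigma>_sa \<tau>_sa rs, metis \<sigma>_sa \<tau>_sa inner_commute, metis inner_commute)
    have "(norm (R x))\<^sup>2 = (x - B x) \<bullet> x" by (simp add: power2_norm_eq_inner saR RR inner_commute)
    moreover have "B x = (1/2) *\<^sub>R (P + Q) + (1/8) *\<^sub>R (P + \<sigma> (\<tau> Q) + (P + \<tau> (\<sigma> Q))) - (1/4) *\<^sub>R (P - Q)"
      using x by (simp add: B_def rs onF)
    moreover have "T x = (1/2) *\<^sub>R (Q - \<sigma> (\<tau> Q)) + J P" using T_split x by simp
    ultimately show ?thesis
      by (simp add: power2_norm_eq_inner x(1) inner_add_left inner_add_right inner_diff_left
          inner_diff_right o i L.J_inner_J) (simp add: field_simps)?
  qed
  have T_inj: "x = 0" if "T x = 0" for x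
  proof -
    obtain P Q where x: "x = P + Q" "P \<in> F" "\<forall>z\<in>F. Q \<bullet> z = 0" "\<rho> x = P - Q" using split by metis
    have "(1/2) *\<^sub>R (Q - \<sigma> (\<tau> Q)) + J P = 0" using T_split x that by simp
    then have z: "(1/2) *\<^sub>R (Q - \<sigma> (\<tau> Q)) = 0 \<and> J P = 0"
      using x orthF F_J by (intro zero_sum) (auto simp: inner_diff_left)
    then have "Q = 0" using offF x by simp
    moreover have "P = 0" using z by (metis L.J_J L.J_simps(1) neg_equal_0_iff_equal)
    ultimately show ?thesis using x by simp
  qed
  have T_dense: "y = 0" if y: "\<And>x. T x \<bullet> y = 0" for y
  proof -
    obtain P Q where yy: "y = P + Q" "P \<in> F" "\<forall>z\<in>F. Q \<bullet> z = 0" "\<rho> y = P - Q" using split by metis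
    have rsa: "\<rho> x \<bullet> z = x \<bullet> \<rho> z" for x z unfolding \<rho>_def by (rule F.reflection_selfadjoint)
    define T' where "T' = (1/2) *\<^sub>R (y - \<tau> (\<sigma> y)) - (1/2) *\<^sub>R J (y + \<rho> y)"
    have "T x \<bullet> y = x \<bullet> T'" for x
      by (simp add: T_def T'_def inner_add_left inner_add_right inner_diff_left inner_diff_right
          \<tau>_sa \<sigma>_sa rs L.J_inner rsa \<rho>_J field_simps)
    then have "T' = 0" using y by (metis inner_eq_zero_iff)
    moreover have "T' = (1/2) *\<^sub>R (Q - \<tau> (\<sigma> Q)) + (- J P)"
      using yy by (simp add: T'_def rs onF)
    ultimately have "(1/2) *\<^sub>R (Q - \<tau> (\<sigma> Q)) + (- J P) = 0" by simp
    moreover have "((1/2) *\<^sub>R (Q - \<tau> (\<sigma> Q))) \<bullet> (- J P) = 0"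
      using yy orthF F_J by (simp add: inner_diff_left)
    ultimately have z: "(1/2) *\<^sub>R (Q - \<tau> (\<sigma> Q)) = 0 \<and> - J P = 0" by (rule zero_sum)
    then have "Q = 0" using offF yy by simp
    moreover have "P = 0" using z by (metis L.J_J L.J_simps(1) neg_equal_0_iff_equal)
    ultimately show ?thesis using yy by simp
  qed
  define R' where "R' x = sqrt 2 *\<^sub>R R x" for x
  have linR': "linear R'" unfolding R'_def
    by (rule linearI) (simp_all add: linear_add[OF linR] linear_scale[OF linR] algebra_simps)
  have nT: "norm (T x) = norm (R' x)" for x
    using TB[of x] by (simp add: R'_def power2_eq_iff_nonneg flip: power_mult_distrib)
      (metis norm_ge_zero power2_eq_iff_nonneg power_mult_distrib real_sqrt_ge_zero
        real_sqrt_pow2 zero_le_mult_iff zero_le_numeral)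
  have "subspace (range R')" "subspace (range T)"
    using linR' bounded_linear.linear[OF blT] by (auto intro!: linear_subspace_image)
  note sub = this
  have dR: "closure (range R') = UNIV"
  proof (rule dense_if_orthogonal_trivial[OF sub(1)])
    fix y assume "\<And>x. x \<in> range R' \<Longrightarrow> x \<bullet> y = 0"
    then have "R' x \<bullet> y = 0" for x by blast
    then have "x \<bullet> R y = 0" for x by (simp add: R'_def saR)
    then have "R' y = 0" by (metis R'_def inner_eq_zero_iff scaleR_zero_right)
    then show "y = 0" using nT[of y] T_inj by simp
  qed
  have dT: "closure (range T) = UNIV"
    by (rule dense_if_orthogonal_trivial[OF sub(2)]) (use T_dense in blast)
  obtain U where U: "bounded_linear U" "surj U" "\<And>x. norm (U x) = norm x" "\<And>x. U (R' x) = T x"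
    using isometry_from_dense_ranges[OF linR' bounded_linear.linear[OF blT] nT dR dT] by metis
  have linU: "linear U" using U(1) by (rule bounded_linear.linear)
  have agree: "f y = g y" if "bounded_linear f" "bounded_linear g" "\<And>x. f (R' x) = g (R' x)"
    for f g :: "'a \<Rightarrow> 'a" and y
  proof -
    have "closed {y. f y = g y}" using that by (intro closed_Collect_eq linear_continuous_on)
    then have "closure (range R') \<subseteq> {y. f y = g y}" using that by (intro closure_minimal) auto
    then show ?thesis using dR by auto
  qed
  have JB: "J (B x) = B (J x)" for x
    by (simp add: B_def ls)
  have \<tau>B: "\<tau> (B x) = B (\<tau> x)" for x
    by (simp add: B_def ls algebra_simps)
  have JR: "J (R' x) = R' (J x)" and \<tau>R: "\<tau> (R' x) = R' (\<tau> x)" for x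
    using comR[OF L.bounded_linear_J JB] comR[OF bl(1) \<tau>B] by (simp_all add: R'_def rs)
  have UJ: "U (J x) = J (U x)" for x
  proof (rule agree[of "\<lambda>x. U (J x)" "\<lambda>x. J (U x)"])
    show "bounded_linear (\<lambda>x. U (J x))" "bounded_linear (\<lambda>x. J (U x))"
      using U(1) L.bounded_linear_J by (auto intro: bounded_linear_compose)
    show "U (J (R' x)) = J (U (R' x))" for x
      by (simp add: JR U(4)) (simp add: T_def ls algebra_simps)
  qed
  have U\<tau>: "\<sigma> (U x) = - U (\<tau> x)" for x
  proof (rule agree[of "\<lambda>x. \<sigma> (U x)" "\<lambda>x. - U (\<tau> x)"])
    show "bounded_linear (\<lambda>x. \<sigma> (U x))" "bounded_linear (\<lambda>x. - U (\<tau> x))"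
      using U(1) bl by (auto intro: bounded_linear_compose bounded_linear_minus)
    fix x
    have "x + \<rho> x \<in> F"
      using split[of x] subspace_scale[OF F.subspace, of _ 2] by (auto simp: scaleR_2)
    then have "\<sigma> (x + \<rho> x) = \<tau> (x + \<rho> x)" by (simp add: F_def)
    then have "J (\<sigma> (x + \<rho> x)) = J (\<tau> (x + \<rho> x))" by simp
    then have "\<sigma> (T x) = - T (\<tau> x)"
      unfolding T_def by (simp add: ls algebra_simps flip: scaleR_add_right)
    then show "\<sigma> (U (R' x)) = - U (\<tau> (R' x))"
      by (simp add: \<tau>R U(4))
  qed
  have inner_U: "U x \<bullet> U y = x \<bullet> y" for x y by (rule linear_isometry_inner[OF linU U(3)])
  have wU: "J (U x) \<bullet> U y = J x \<bullet> y" for x y by (simp add: inner_U flip: UJ)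
  have "unitary_op \<omega> J U"
    unfolding unitary_op_def jscale_def herm_def L.omega_eq
    using U(1,2) by (simp add: linear_add[OF linU] linear_scale[OF linU] UJ inner_U wU)
  then show thesis using that U\<tau> unfolding \<tau>_def \<sigma>_def by blast
qed

lemma unitary_op_isometry:
  assumes U: "unitary_op \<omega> J U"
  shows "linear U" "surj U" "U x \<bullet> U y = x \<bullet> y" "inj U"
proof -
  show l: "linear U" and "surj U" using U by (auto simp: unitary_op_def bounded_linear.linear)
  have "Re (herm \<omega> (U x) (U y)) = Re (herm \<omega> x y)" for x y
    using U by (simp add: unitary_op_def)
  then have i: "U x \<bullet> U y = x \<bullet> y" for x y by (simp add: herm_def)
  then show "U x \<bullet> U y = x \<bullet> y" .
  show "inj U"
  proof (rule injI)
    fix x y assume "U x = U y"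
    then have "U (x - y) \<bullet> U (x - y) = 0" by (simp add: linear_diff[OF l])
    then show "x = y" by (simp add: i)
  qed
qed

text \<open>Conjugating the reflection in \<open>L\<close> by a unitary \<open>U\<close> that carries the complement of \<open>L\<close> onto \<open>M\<close>
  gives the antilinear operator that is \<open>- 1\<close> on \<open>M\<close> and \<open>1\<close> on \<open>J M\<close>, whatever \<open>U\<close> is.\<close>

lemma unitary_conjugation_eq_reflections:
  assumes "symplectic_hilbert \<omega> J" "lagrangian \<omega> L" "lagrangian \<omega> M"
    and U: "unitary_op \<omega> J U" and M: "M = U ` (L\<^sup>\<bottom>)"
  shows "U \<circ> lagr_conj J L \<circ> herm_adjoint \<omega> U \<circ> lagr_conj J L = (\<lambda>x. - reflection M (reflection L x))"
proof -
  interpret L: lagrangian_subspace \<omega> J L using assms by unfold_locales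
  interpret M: lagrangian_subspace \<omega> J M using assms by unfold_locales
  have linU: "linear U" and sU: "surj U" and inner_U: "\<And>x y. U x \<bullet> U y = x \<bullet> y" and "inj U"
    using unitary_op_isometry[OF U] by auto
  have hU: "herm \<omega> (U x) (U y) = herm \<omega> x y" for x y using U by (simp add: unitary_op_def)
  have UJ: "U (J x) = J (U x)" for x
  proof -
    have "U (jscale J \<i> x) = jscale J \<i> (U x)" using U by (simp add: unitary_op_def)
    then show ?thesis by (simp add: jscale_def)
  qed
  have Re_herm: "Re (herm \<omega> x y) = x \<bullet> y" for x y by (simp add: herm_def)
  from \<open>inj U\<close> have inv: "inv U (U x) = x" for x by simp
  have inv': "U (inv U x) = x" for x using sU by (simp add: surj_f_inv_f)
  have adj: "herm_adjoint \<omega> U = inv U"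
  proof -
    have "\<forall>x y. herm \<omega> (U x) y = herm \<omega> x (inv U y)"
      using hU inv' by metis
    then have "\<forall>x y. herm \<omega> (U x) y = herm \<omega> x (herm_adjoint \<omega> U y)"
      unfolding herm_adjoint_def
      by (rule someI[where P = "\<lambda>V. \<forall>x y. herm \<omega> (U x) y = herm \<omega> x (V y)"])
    then have "Re (herm \<omega> (U x) y) = x \<bullet> herm_adjoint \<omega> U y" for x y by (simp add: Re_herm)
    moreover have "Re (herm \<omega> (U x) y) = x \<bullet> inv U y" for x y using inner_U inv' Re_herm by metis
    ultimately show ?thesis by (metis ext vector_eq_rdot inner_commute)
  qed
  have "U (reflection L (inv U z)) = - reflection M z" for z
  proof -
    obtain p q where z: "z = p + q" "p \<in> M" "\<And>y. y \<in> M \<Longrightarrow> q \<bullet> y = 0"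
      using M.decompose[of z] by metis
    have Jq: "J q \<in> M" using z M.orthogonal_iff_J_in by blast
    obtain p' where p': "p = U p'" "p' \<in> L\<^sup>\<bottom>" using z M by blast
    obtain r where r: "J q = U r" "r \<in> L\<^sup>\<bottom>" using Jq M by blast
    have q: "q = U (- J r)" using r(1) L.J_J[of q] by (simp add: linear_neg[OF linU] UJ)
    have "- J r \<in> L"
      using r(2) L.orthogonal_comp_eq L.orthogonal_iff_J_in subspace_neg[OF L.subspace] by blast
    then have "reflection L (- J r + p') = - J r - p'"
      using p'(2) L.orthogonal_comp_eq by (intro L.reflection_eq) auto
    moreover have "inv U z = - J r + p'"
      using z(1) p'(1) q by (simp add: linear_add[OF linU, symmetric] inv add.commute)
    ultimately have "U (reflection L (inv U z)) = q - p"
      using p'(1) q by (simp add: linear_diff[OF linU])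
    then show ?thesis using M.reflection_eq[of p q] z by simp
  qed
  then show ?thesis
    by (auto simp: adj L.lagr_conj_eq_reflection fun_eq_iff)
qed

lemma souriau_eq_reflections:
  assumes "symplectic_hilbert \<omega> J" "lagrangian \<omega> L" "lagrangian \<omega> M"
  shows "souriau \<omega> J L M = (\<lambda>x. - reflection M (reflection L x))"
proof -
  interpret L: lagrangian_subspace \<omega> J L using assms by unfold_locales
  interpret M: lagrangian_subspace \<omega> J M using assms by unfold_locales
  obtain U where U: "unitary_op \<omega> J U" and i: "\<And>x. reflection M (U x) = - U (reflection L x)"
    using intertwining_unitary_exists[OF assms] by metis
  have linU: "linear U" and sU: "surj U" and injU: "\<And>x y. U x = U y \<Longrightarrow> x = y"
    using unitary_op_isometry[OF U] by (auto dest: injD)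
  have perp: "x \<in> L\<^sup>\<bottom> \<longleftrightarrow> U x \<in> M" for x
  proof -
    have "x \<in> L\<^sup>\<bottom> \<longleftrightarrow> reflection L x = - x"
      by (simp add: L.orthogonal_comp_eq L.reflection_eq_minus_iff)
    also have "\<dots> \<longleftrightarrow> U (reflection L x) = - U x"
      using injU linear_neg[OF linU] by metis
    also have "\<dots> \<longleftrightarrow> reflection M (U x) = U x"
      by (simp add: i) (metis minus_minus)
    finally show ?thesis by (simp add: M.reflection_eq_self_iff)
  qed
  then have "M = U ` (L\<^sup>\<bottom>)" using sU by (auto simp: image_iff) (metis surjD)
  then show ?thesis
    unfolding souriau_def
    using U unitary_conjugation_eq_reflections[OF assms] by (intro the_equality) metis+
qed

section \<open>Unitary operators with finite spectrum\<close>

sublocale symplectic_space \<subseteq> C: vector_space "jscale J"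
  by (rule vector_space_jscale[OF symplectic])

context symplectic_space
begin

abbreviation cscale (infixr "\<odot>" 75) where "c \<odot> x \<equiv> jscale J c x"

lemma cscale_scaleR: "complex_of_real r \<odot> x = r *\<^sub>R x"
  by (simp add: jscale_def)

lemma inner_cscale: "(c \<odot> x) \<bullet> y = x \<bullet> (cnj c \<odot> y)"
  by (simp add: jscale_def inner_add_left inner_add_right inner_diff_right J_inner)

lemma norm_cscale: "norm (c \<odot> x) = cmod c * norm x"
proof -
  have "(c \<odot> x) \<bullet> (c \<odot> x) = x \<bullet> (complex_of_real ((cmod c)\<^sup>2) \<odot> x)"
    by (simp only: inner_cscale C.scale_scale mult.commute[of "cnj c"] complex_norm_square[symmetric])
  then show ?thesis
    by (simp only: cscale_scaleR norm_eq_sqrt_inner inner_scaleR_right real_sqrt_mult) simp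
qed

lemma linear_cscale: "linear (jscale J c)"
proof (rule linearI)
  show "c \<odot> (r *\<^sub>R x) = r *\<^sub>R (c \<odot> x)" for r x
    by (simp add: jscale_def J_simps algebra_simps)
qed (rule C.scale_right_distrib)

end

locale complex_isometry = symplectic_space +
  fixes W
  assumes linear_W: "linear W" and W_J: "W (J x) = J (W x)" and norm_W: "norm (W x) = norm x"
begin

lemmas W_simps = linear_0[OF linear_W] linear_add[OF linear_W] linear_diff[OF linear_W]
  linear_neg[OF linear_W] linear_scale[OF linear_W]

lemma W_cscale: "W (c \<odot> x) = c \<odot> W x"
  by (simp add: jscale_def W_simps W_J)

lemma W_inner: "W x \<bullet> W y = x \<bullet> y"
  by (rule linear_isometry_inner[OF linear_W norm_W])

lemma bounded_linear_W: "bounded_linear W"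
  by (rule bounded_linear_intro[of _ 1]) (auto simp: W_simps norm_W)

text \<open>Horner evaluation of a complex polynomial at \<open>W\<close>, with complex scalars acting through \<open>J\<close>.\<close>

definition poly_op :: "complex poly \<Rightarrow> 'a \<Rightarrow> 'a" where
  "poly_op p = fold_coeffs (\<lambda>a f x. a \<odot> x + W (f x)) p (\<lambda>x. 0)"

lemma poly_op_0: "poly_op 0 x = 0"
  by (simp add: poly_op_def)

lemma poly_op_pCons: "poly_op (pCons a p) x = a \<odot> x + W (poly_op p x)"
  by (cases "p = 0 \<and> a = 0") (auto simp: poly_op_def W_simps)

lemma poly_op_add: "poly_op (p + q) x = poly_op p x + poly_op q x"
  by (induction p q rule: poly_induct2)
    (simp_all add: poly_op_0 poly_op_pCons W_simps C.scale_left_distrib)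

lemma poly_op_smult: "poly_op (smult c p) x = c \<odot> poly_op p x"
  by (induction p) (simp_all add: poly_op_0 poly_op_pCons C.scale_right_distrib W_cscale)

lemma poly_op_mult: "poly_op (p * q) x = poly_op p (poly_op q x)"
  by (induction p) (simp_all add: poly_op_0 poly_op_pCons poly_op_add poly_op_smult)

lemma poly_op_linear_factor: "poly_op [:- w, 1:] x = W x - w \<odot> x"
  by (simp add: poly_op_0 poly_op_pCons W_simps)

lemma bounded_linear_poly_op: "bounded_linear (poly_op p)"
proof (induction p)
  case 0
  have "poly_op 0 = (\<lambda>x. 0)" by (simp add: fun_eq_iff poly_op_0)
  then show ?case by simp
next
  case (pCons a p)
  have "bounded_linear (jscale J a)"
    by (rule bounded_linear_intro[of _ "cmod a"])
      (auto simp: linear_add[OF linear_cscale] linear_scale[OF linear_cscale] norm_cscale)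
  then show ?case
    using bounded_linear_add[OF _ bounded_linear_compose[OF bounded_linear_W pCons.IH]]
    unfolding poly_op_pCons[abs_def] by blast
qed

lemma poly_op_monom: "poly_op (monom c n) x = c \<odot> (W ^^ n) x"
  by (induction n) (simp_all add: monom_0 monom_Suc poly_op_pCons poly_op_0 W_simps W_cscale)

definition bounded_below :: "('a \<Rightarrow> 'a) \<Rightarrow> bool" where
  "bounded_below f \<longleftrightarrow> (\<exists>c>0. \<forall>x. c * norm x \<le> norm (f x))"

text \<open>Factor the polynomial into linear factors.\<close>

lemma poly_op_bounded_below:
  assumes "p \<noteq> 0" and "\<And>w. poly p w = 0 \<Longrightarrow> bounded_below (\<lambda>x. W x - w \<odot> x)"
  shows "bounded_below (poly_op p)"
  using assms
proof (induction "degree p" arbitrary: p)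
  case 0
  then obtain a where p: "p = [:a:]" "a \<noteq> 0" by (metis degree_eq_zeroE pCons_0_0)
  show ?case unfolding bounded_below_def
    by (rule exI[of _ "cmod a"]) (simp add: p poly_op_pCons poly_op_0 W_simps norm_cscale)
next
  case (Suc n)
  then have "\<not> constant (poly p)" by (simp add: constant_degree)
  then obtain w where w: "poly p w = 0" using fundamental_theorem_of_algebra by blast
  then obtain q where q: "p = [:- w, 1:] * q" by (metis dvdE poly_eq_0_iff_dvd)
  have q0: "q \<noteq> 0" using Suc.prems(1) q by auto
  then have dq: "degree p = Suc (degree q)" unfolding q by (subst degree_mult_eq) auto
  have "bounded_below (poly_op q)"
    using dq Suc.hyps(2) q0 Suc.prems(2) by (intro Suc.hyps(1)) (auto simp: q)
  then obtain c where c: "c > 0" "\<And>x. c * norm x \<le> norm (poly_op q x)"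
    by (auto simp: bounded_below_def)
  obtain d where d: "d > 0" "\<And>x. d * norm x \<le> norm (W x - w \<odot> x)"
    using Suc.prems(2)[OF w] by (auto simp: bounded_below_def)
  have "d * c * norm x \<le> norm (poly_op p x)" for x
  proof -
    have "d * (c * norm x) \<le> d * norm (poly_op q x)" using c d by (intro mult_left_mono) auto
    also have "\<dots> \<le> norm (poly_op p x)"
      using d(2)[of "poly_op q x"] by (simp only: q poly_op_mult poly_op_linear_factor)
    finally show ?thesis by simp
  qed
  then show ?case unfolding bounded_below_def using c d by (intro exI[of _ "d * c"]) auto
qed

lemma bounded_below_off_circle:
  assumes "cmod w \<noteq> 1"
  shows "bounded_below (\<lambda>x. W x - w \<odot> x)"
  unfolding bounded_below_def
proof (intro exI[of _ "\<bar>1 - cmod w\<bar>"] conjI allI)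
  show "\<bar>1 - cmod w\<bar> > 0" using assms by simp
  show "\<bar>1 - cmod w\<bar> * norm x \<le> norm (W x - w \<odot> x)" for x
  proof -
    have "\<bar>1 - cmod w\<bar> * norm x = \<bar>norm (W x) - norm (w \<odot> x)\<bar>"
    proof -
      have "norm (W x) - norm (w \<odot> x) = (1 - cmod w) * norm x"
        by (simp add: norm_W norm_cscale left_diff_distrib)
      then show ?thesis by (simp add: abs_mult)
    qed
    also have "\<dots> \<le> norm (W x - w \<odot> x)" by (rule norm_triangle_ineq3)
    finally show ?thesis .
  qed
qed

definition ann :: "complex set \<Rightarrow> complex poly" where
  "ann S = (\<Prod>z\<in>S. [:- z, 1:])"

lemma ann_insert: "finite S \<Longrightarrow> z \<notin> S \<Longrightarrow> ann (insert z S) = [:- z, 1:] * ann S"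
  by (simp add: ann_def)

text \<open>For unitary \<open>W\<close> and \<open>z\<close> on the unit circle, the adjoint of \<open>W - z\<close> is \<open>- cnj z\<close> times the inverse of \<open>W\<close> times
  \<open>W - z\<close>.  Multiplying over \<open>S\<close> expresses the adjoint of \<open>ann S\<close> evaluated at \<open>W\<close> through that
  operator itself; moving the powers of \<open>W\<close> to the other side avoids the inverse.\<close>

lemma ann_adjoint:
  assumes "finite S" "\<And>z. z \<in> S \<Longrightarrow> cmod z = 1"
  shows "poly_op (ann S) y \<bullet> ((\<Prod>z\<in>S. - z) \<odot> (W ^^ card S) x) = y \<bullet> poly_op (ann S) x"
  using assms
proof (induction S arbitrary: x y rule: finite_induct)
  case empty
  show ?case by (simp add: ann_def one_pCons poly_op_pCons poly_op_0 W_simps)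
next
  case (insert z S)
  have zz: "z * cnj z = 1" using insert.prems[of z] by (simp add: complex_norm_square[symmetric])
  have one: "(W y - z \<odot> y) \<bullet> (- z \<odot> W x) = y \<bullet> (W x - z \<odot> x)" for x y
  proof -
    have "W y \<bullet> (- z \<odot> W x) = y \<bullet> (- z \<odot> x)"
      by (simp only: W_cscale[symmetric] W_inner)
    moreover have "(z \<odot> y) \<bullet> (- z \<odot> W x) = - (y \<bullet> W x)"
      using zz by (simp add: inner_cscale mult.commute[of "cnj z"])
    ultimately show ?thesis by (simp add: inner_diff_left inner_diff_right)
  qed
  have ann: "poly_op (ann (insert z S)) v = W (poly_op (ann S) v) - z \<odot> poly_op (ann S) v" for v
    by (simp only: ann_insert[OF insert.hyps] poly_op_mult poly_op_linear_factor)
  have comm: "poly_op (ann S) (W v - z \<odot> v) = W (poly_op (ann S) v) - z \<odot> poly_op (ann S) v" for v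
    by (simp only: poly_op_linear_factor[symmetric] poly_op_mult[symmetric] mult.commute)
  have "poly_op (ann (insert z S)) y \<bullet> ((\<Prod>z\<in>insert z S. - z) \<odot> (W ^^ card (insert z S)) x)
      = (W (poly_op (ann S) y) - z \<odot> poly_op (ann S) y) \<bullet> (- z \<odot> W ((\<Prod>z\<in>S. - z) \<odot> (W ^^ card S) x))"
    using insert.hyps by (simp add: ann W_cscale)
  also have "\<dots> = poly_op (ann S) y \<bullet> (W ((\<Prod>z\<in>S. - z) \<odot> (W ^^ card S) x) - z \<odot> ((\<Prod>z\<in>S. - z) \<odot> (W ^^ card S) x))"
    by (rule one)
  also have "\<dots> = poly_op (ann S) y \<bullet> ((\<Prod>z\<in>S. - z) \<odot> (W ^^ card S) (W x - z \<odot> x))"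
  proof -
    have lin: "(W ^^ n) (u - v) = (W ^^ n) u - (W ^^ n) v" "(W ^^ n) (c \<odot> u) = c \<odot> (W ^^ n) u" for n u v c
      by (induction n) (simp_all add: W_simps W_cscale)
    have "(W ^^ card S) (W x) = W ((W ^^ card S) x)" by (simp add: funpow_swap1)
    then show ?thesis by (simp add: lin W_cscale C.scale_right_diff_distrib mult.commute)
  qed
  also have "\<dots> = y \<bullet> poly_op (ann S) (W x - z \<odot> x)"
    using insert by blast
  finally show ?case by (simp only: comm ann)
qed

text \<open>A polynomial that vanishes on the approximate point spectrum of \<open>W\<close> annihilates it.  Let \<open>K\<close>
  be the norm of \<open>A\<close>, the value of \<open>ann S\<close> at \<open>W\<close>.  Up to powers of \<open>W\<close> and a unit scalar, the
  operator \<open>K\<^sup>2\<close> minus the adjoint of \<open>A\<close> times \<open>A\<close> is a polynomial \<open>r\<close> in \<open>W\<close> whose roots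
  avoid \<open>S\<close> when \<open>K\<close> is nonzero.  Then it is bounded below, which contradicts that \<open>A\<close> comes close to
  attaining its norm.  A nonempty \<open>S\<close> ensures that \<open>r\<close> is not the zero polynomial.\<close>

lemma ann_eq_0:
  assumes S: "finite S" "S \<noteq> {}" "\<And>z. z \<in> S \<Longrightarrow> cmod z = 1"
    and bb: "\<And>w. cmod w = 1 \<Longrightarrow> w \<notin> S \<Longrightarrow> bounded_below (\<lambda>x. W x - w \<odot> x)"
  shows "poly_op (ann S) x = 0"
proof -
  define A where "A = poly_op (ann S)"
  define K where "K = onorm A"
  define u where "u = (\<Prod>z\<in>S. - z)"
  define n where "n = card S"
  have bl: "bounded_linear A" unfolding A_def by (rule bounded_linear_poly_op)
  have K: "norm (A x) \<le> K * norm x" for x unfolding K_def by (rule onorm[OF bl])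
  have "K = 0"
  proof (rule ccontr)
    assume "K \<noteq> 0"
    then have K0: "K > 0" using onorm_pos_le[OF bl] by (simp add: K_def)
    define r where "r = ann S * ann S - monom (complex_of_real (K\<^sup>2) * u) n"
    have cu: "cmod u = 1" using S by (simp add: u_def prod_norm[symmetric])
    have rS: "poly r z \<noteq> 0" if "z \<in> S" for z
    proof -
      have "poly (ann S) z = 0" using that S by (auto simp: ann_def poly_prod intro!: prod_zero)
      moreover have "u \<noteq> 0" "z \<noteq> 0" using cu S(3)[OF that] by auto
      ultimately show ?thesis using K0 by (simp add: r_def poly_monom)
    qed
    have "r \<noteq> 0" using rS S(2) by auto
    then have "bounded_below (poly_op r)"
      using rS bb bounded_below_off_circle by (intro poly_op_bounded_below) auto
    then obtain c where c: "c > 0" "\<And>x. c * norm x \<le> norm (poly_op r x)"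
      by (auto simp: bounded_below_def)
    have r: "poly_op r x = A (A x) - K\<^sup>2 *\<^sub>R (u \<odot> (W ^^ n) x)" for x
    proof -
      have "r = ann S * ann S + monom (- (complex_of_real (K\<^sup>2) * u)) n" by (simp add: r_def minus_monom)
      then have "poly_op r x = A (A x) + (- (complex_of_real (K\<^sup>2) * u)) \<odot> (W ^^ n) x"
        by (simp only: poly_op_add poly_op_mult poly_op_monom A_def)
      also have "\<dots> = A (A x) - complex_of_real (K\<^sup>2) \<odot> (u \<odot> (W ^^ n) x)" by simp
      finally show ?thesis by (simp only: cscale_scaleR)
    qed
    have nW: "norm ((W ^^ n) x) = norm x" for x by (induction n) (simp_all add: norm_W)
    have sq: "(norm (a - k *\<^sub>R b))\<^sup>2 = (norm a)\<^sup>2 - 2 * k * (a \<bullet> b) + k\<^sup>2 * (norm b)\<^sup>2"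
      for a b :: 'a and k :: real
      unfolding power2_norm_eq_inner
      by (simp add: inner_diff_left inner_diff_right inner_commute power2_eq_square algebra_simps)
    have est: "(norm (A x))\<^sup>2 \<le> (K\<^sup>2 - c\<^sup>2 / K\<^sup>2) * (norm x)\<^sup>2" for x
    proof -
      have "(c * norm x)\<^sup>2 \<le> (norm (poly_op r x))\<^sup>2" using c by (intro power_mono) auto
      also have "\<dots> = (norm (A (A x)))\<^sup>2 - 2 * K\<^sup>2 * (A (A x) \<bullet> (u \<odot> (W ^^ n) x))
          + (K\<^sup>2)\<^sup>2 * (norm (u \<odot> (W ^^ n) x))\<^sup>2"
        unfolding r by (rule sq)
      also have "A (A x) \<bullet> (u \<odot> (W ^^ n) x) = (norm (A x))\<^sup>2"
        unfolding A_def u_def n_def using ann_adjoint[OF S(1,3)] by (simp add: power2_norm_eq_inner)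
      also have "norm (u \<odot> (W ^^ n) x) = norm x" by (simp add: norm_cscale cu nW)
      also have "(norm (A (A x)))\<^sup>2 \<le> K\<^sup>2 * (norm (A x))\<^sup>2"
        using power_mono[OF K[of "A x"], of 2] by (simp add: power_mult_distrib)
      finally have "c\<^sup>2 * (norm x)\<^sup>2 \<le> K\<^sup>2 * (K\<^sup>2 * (norm x)\<^sup>2 - (norm (A x))\<^sup>2)"
        by (simp add: power_mult_distrib algebra_simps power2_eq_square)
      then have "c\<^sup>2 * (norm x)\<^sup>2 / K\<^sup>2 \<le> K\<^sup>2 * (norm x)\<^sup>2 - (norm (A x))\<^sup>2"
        using K0 by (simp add: pos_divide_le_eq mult.commute)
      then show ?thesis by (simp add: left_diff_distrib)
    qed
    define q where "q = max 0 (K\<^sup>2 - c\<^sup>2 / K\<^sup>2)"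
    have "norm (A x) \<le> sqrt q * norm x" for x
    proof -
      have "(norm (A x))\<^sup>2 \<le> q * (norm x)\<^sup>2"
        using est[of x] mult_right_mono[of "K\<^sup>2 - c\<^sup>2 / K\<^sup>2" q "(norm x)\<^sup>2"]
        by (simp add: q_def)
      then have "sqrt ((norm (A x))\<^sup>2) \<le> sqrt (q * (norm x)\<^sup>2)" by (rule real_sqrt_le_mono)
      then show ?thesis by (simp add: real_sqrt_mult)
    qed
    then have "K \<le> sqrt q" unfolding K_def by (intro onorm_bound) (auto simp: q_def)
    then have "K\<^sup>2 \<le> q" using K0 power_mono[of K "sqrt q" 2] by (simp add: q_def)
    moreover have "c\<^sup>2 / K\<^sup>2 > 0" "K\<^sup>2 > 0" using c K0 by simp_all
    ultimately show False unfolding q_def by linarith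
  qed
  then show ?thesis using K[of x] by (simp add: A_def)
qed

abbreviation eig :: "complex \<Rightarrow> 'a set" where "eig \<equiv> eigenspace J W"

lemma eig_iff: "x \<in> eig z \<longleftrightarrow> W x = z \<odot> x"
  by (simp add: eigenspace_def)

lemma subspace_eig: "C.subspace (eig z)"
  by (rule C.subspaceI)
    (auto simp: eig_iff W_simps W_cscale C.scale_right_distrib mult.commute)

definition eig_sum :: "complex set \<Rightarrow> 'a set" where
  "eig_sum S = {\<Sum>z\<in>S. v z |v. \<forall>z\<in>S. v z \<in> eig z}"

lemma eig_sum_empty: "eig_sum {} = {0}"
  by (auto simp: eig_sum_def)

lemma eig_sum_insert:
  assumes "finite S" "z \<notin> S"
  shows "eig_sum (insert z S) = {x + y |x y. x \<in> eig z \<and> y \<in> eig_sum S}"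
proof (intro equalityI subsetI)
  fix x assume "x \<in> eig_sum (insert z S)"
  then obtain v where "x = (\<Sum>z\<in>insert z S. v z)" "\<forall>w\<in>insert z S. v w \<in> eig w"
    by (auto simp: eig_sum_def)
  then show "x \<in> {x + y |x y. x \<in> eig z \<and> y \<in> eig_sum S}"
    using assms by (auto simp: eig_sum_def)
next
  fix x assume "x \<in> {x + y |x y. x \<in> eig z \<and> y \<in> eig_sum S}"
  then obtain a v where x: "x = a + (\<Sum>z\<in>S. v z)" "a \<in> eig z" "\<forall>w\<in>S. v w \<in> eig w"
    by (auto simp: eig_sum_def)
  have "(\<Sum>w\<in>S. (v(z := a)) w) = (\<Sum>w\<in>S. v w)" using assms by (intro sum.cong) auto
  then have "x = (\<Sum>w\<in>insert z S. (v(z := a)) w)" using assms x by simp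
  then show "x \<in> eig_sum (insert z S)"
    using x unfolding eig_sum_def mem_Collect_eq by (intro exI[of _ "v(z := a)"]) auto
qed

lemma subspace_eig_sum: "finite S \<Longrightarrow> C.subspace (eig_sum S)"
  by (induction S rule: finite_induct)
    (auto simp: eig_sum_empty eig_sum_insert intro!: C.subspace_sums subspace_eig)

text \<open>Induction on \<open>S\<close>: the vector \<open>W x - w x\<close> is a sum of eigenvectors for the other eigenvalues, on each of
  which \<open>W - w\<close> is a nonzero scalar; dividing by these scalars and subtracting the resulting sum
  from \<open>x\<close> leaves an eigenvector for \<open>w\<close>.\<close>

lemma eig_sum_if_ann:
  assumes "finite S" "poly_op (ann S) x = 0"
  shows "x \<in> eig_sum S"
  using assms
proof (induction S arbitrary: x rule: finite_induct)
  case empty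
  then show ?case by (simp add: ann_def one_pCons poly_op_pCons poly_op_0 W_simps eig_sum_empty)
next
  case (insert w S)
  have "poly_op (ann S) (W x - w \<odot> x) = 0"
    using insert.prems
    by (simp only: ann_insert[OF insert.hyps] poly_op_linear_factor[symmetric] poly_op_mult[symmetric] mult.commute)
  then obtain v where v: "W x - w \<odot> x = (\<Sum>z\<in>S. v z)" "\<forall>z\<in>S. v z \<in> eig z"
    using insert.IH by (fastforce simp: eig_sum_def)
  define y where "y = (\<Sum>z\<in>S. inverse (z - w) \<odot> v z)"
  have "W y - w \<odot> y = (\<Sum>z\<in>S. v z)"
    unfolding y_def linear_sum[OF linear_W] C.scale_sum_right sum_subtractf[symmetric]
  proof (rule sum.cong[OF refl])
    fix z assume z: "z \<in> S"
    then have "z - w \<noteq> 0" using insert.hyps by auto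
    have wv: "W (v z) = z \<odot> v z" using v(2) z by (simp add: eig_iff)
    have "W (inverse (z - w) \<odot> v z) - w \<odot> (inverse (z - w) \<odot> v z)
        = (inverse (z - w) * z) \<odot> v z - (w * inverse (z - w)) \<odot> v z"
      by (simp only: W_cscale wv C.scale_scale)
    also have "\<dots> = (inverse (z - w) * (z - w)) \<odot> v z"
      by (simp only: C.scale_left_diff_distrib[symmetric] right_diff_distrib mult.commute[of w])
    finally show "W (inverse (z - w) \<odot> v z) - w \<odot> (inverse (z - w) \<odot> v z) = v z"
      using \<open>z - w \<noteq> 0\<close> by simp
  qed
  then have "W (x - y) - w \<odot> (x - y) = 0"
    using v(1) by (simp add: W_simps C.scale_right_diff_distrib algebra_simps)
  then have "x - y \<in> eig w" by (simp add: eigenspace_def)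
  moreover have "y \<in> eig_sum S"
    unfolding eig_sum_def y_def using v(2) C.subspace_scale[OF subspace_eig] by blast
  ultimately show ?case
    unfolding eig_sum_insert[OF insert.hyps] by (metis (mono_tags, lifting) diff_add_cancel mem_Collect_eq)
qed

lemma eigenvalue_unit: "eig z \<noteq> {0} \<Longrightarrow> cmod z = 1"
proof -
  assume "eig z \<noteq> {0}"
  then obtain x where "x \<in> eig z" "x \<noteq> 0" using C.subspace_0[OF subspace_eig] by blast
  then show ?thesis using norm_W[of x] by (simp add: eig_iff norm_cscale)
qed

lemma eig_orthogonal:
  assumes "x \<in> eig z" "y \<in> eig w" "z \<noteq> w" "cmod z = 1"
  shows "x \<bullet> y = 0"
proof -
  have zz: "cnj z * z = 1" using assms(4) by (metis complex_norm_square mult.commute of_real_1 power_one)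
  define a where "a = w * cnj z - 1"
  have "a \<noteq> 0"
  proof
    assume "a = 0"
    then have "w * (cnj z * z) = z" by (simp add: a_def mult.assoc[symmetric])
    then show False using zz assms(3) by simp
  qed
  define y' where "y' = inverse a \<odot> y"
  have y': "W y' = w \<odot> y'" using assms(2) by (simp add: y'_def W_cscale eig_iff mult.commute)
  have "x \<bullet> y' = W x \<bullet> W y'" by (simp add: W_inner)
  also have "\<dots> = x \<bullet> (cnj z \<odot> (w \<odot> y'))" using assms(1) y' by (simp only: eig_iff inner_cscale)
  finally have "x \<bullet> (a \<odot> y') = 0"
    by (simp add: a_def C.scale_left_diff_distrib inner_diff_right mult.commute)
  then show ?thesis using \<open>a \<noteq> 0\<close> by (simp add: y'_def)
qed

lemma eig_form:
  assumes S: "finite S" "\<And>z. z \<in> S \<Longrightarrow> cmod z = 1" and v: "\<And>z. z \<in> S \<Longrightarrow> v z \<in> eig z"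
  shows "W (\<Sum>z\<in>S. v z) \<bullet> (c \<odot> (\<Sum>z\<in>S. v z)) = (\<Sum>z\<in>S. Re (z * cnj c) * (norm (v z))\<^sup>2)"
proof -
  have "W (\<Sum>z\<in>S. v z) \<bullet> (c \<odot> (\<Sum>z\<in>S. v z)) = (\<Sum>z\<in>S. \<Sum>w\<in>S. W (v z) \<bullet> (c \<odot> v w))"
    by (simp add: linear_sum[OF linear_W] C.scale_sum_right inner_sum_left inner_sum_right)
      (rule sum.swap)
  also have "\<dots> = (\<Sum>z\<in>S. \<Sum>w\<in>S. if w = z then W (v z) \<bullet> (c \<odot> v z) else 0)"
  proof (intro sum.cong refl)
    fix z w assume "z \<in> S" "w \<in> S"
    then show "W (v z) \<bullet> (c \<odot> v w) = (if w = z then W (v z) \<bullet> (c \<odot> v z) else 0)"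
      using eig_orthogonal[of "z \<odot> v z" z "c \<odot> v w" w] v S(2)
        C.subspace_scale[OF subspace_eig] by (auto simp: eig_iff)
  qed
  also have "\<dots> = (\<Sum>z\<in>S. W (v z) \<bullet> (c \<odot> v z))"
    using S(1) by (intro sum.cong refl) (simp add: sum.delta')
  also have "\<dots> = (\<Sum>z\<in>S. Re (z * cnj c) * (norm (v z))\<^sup>2)"
  proof (intro sum.cong refl)
    fix z assume "z \<in> S"
    then have "W (v z) \<bullet> (c \<odot> v z) = v z \<bullet> ((cnj z * c) \<odot> v z)"
      using v by (simp add: eig_iff inner_cscale)
    also have "\<dots> = Re (cnj z * c) * (norm (v z))\<^sup>2 + Im (cnj z * c) * (v z \<bullet> J (v z))"
      by (simp add: jscale_def inner_add_right power2_norm_eq_inner)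
    also have "v z \<bullet> J (v z) = 0" using J_inner[of "v z" "v z"] by (simp add: inner_commute)
    finally show "W (v z) \<bullet> (c \<odot> v z) = Re (z * cnj c) * (norm (v z))\<^sup>2" by simp
  qed
  finally show ?thesis .
qed

lemma eig_norm:
  assumes S: "finite S" "\<And>z. z \<in> S \<Longrightarrow> cmod z = 1" and v: "\<And>z. z \<in> S \<Longrightarrow> v z \<in> eig z"
  shows "(norm (\<Sum>z\<in>S. v z))\<^sup>2 = (\<Sum>z\<in>S. (norm (v z))\<^sup>2)"
proof -
  have "(norm (\<Sum>z\<in>S. v z))\<^sup>2 = (\<Sum>z\<in>S. \<Sum>w\<in>S. v z \<bullet> v w)"
    by (simp add: power2_norm_eq_inner inner_sum_left inner_sum_right) (rule sum.swap)
  also have "\<dots> = (\<Sum>z\<in>S. \<Sum>w\<in>S. if w = z then (norm (v z))\<^sup>2 else 0)"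
    using eig_orthogonal[OF v v] S(2) by (intro sum.cong refl) (auto simp: power2_norm_eq_inner)
  also have "\<dots> = (\<Sum>z\<in>S. (norm (v z))\<^sup>2)"
    using S(1) by (intro sum.cong refl) (simp add: sum.delta')
  finally show ?thesis .
qed

lemma eig_sum_form_ge:
  assumes S: "finite S" "\<And>z. z \<in> S \<Longrightarrow> cmod z = 1" and x: "x \<in> eig_sum S"
    and ge: "\<And>z. z \<in> S \<Longrightarrow> k \<le> Re (z * cnj c)"
  shows "k * (norm x)\<^sup>2 \<le> W x \<bullet> (c \<odot> x)"
proof -
  obtain v where v: "x = (\<Sum>z\<in>S. v z)" "\<And>z. z \<in> S \<Longrightarrow> v z \<in> eig z"
    using x by (auto simp: eig_sum_def)
  have "W x \<bullet> (c \<odot> x) = (\<Sum>z\<in>S. Re (z * cnj c) * (norm (v z))\<^sup>2)"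
    unfolding v(1) by (rule eig_form) (use S v in auto)
  moreover have "(norm x)\<^sup>2 = (\<Sum>z\<in>S. (norm (v z))\<^sup>2)"
    unfolding v(1) by (rule eig_norm) (use S v in auto)
  moreover have "(\<Sum>z\<in>S. k * (norm (v z))\<^sup>2) \<le> (\<Sum>z\<in>S. Re (z * cnj c) * (norm (v z))\<^sup>2)"
    by (intro sum_mono mult_right_mono ge) auto
  ultimately show ?thesis by (simp add: sum_distrib_left)
qed

lemma eig_sum_form_le:
  assumes "finite S" "\<And>z. z \<in> S \<Longrightarrow> cmod z = 1" "x \<in> eig_sum S"
    and "\<And>z. z \<in> S \<Longrightarrow> Re (z * cnj c) \<le> k"
  shows "W x \<bullet> (c \<odot> x) \<le> k * (norm x)\<^sup>2"
proof -
  have "- k * (norm x)\<^sup>2 \<le> W x \<bullet> (- c \<odot> x)"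
  proof (rule eig_sum_form_ge[OF assms(1-3)])
    show "- k \<le> Re (z * cnj (- c))" if "z \<in> S" for z using assms(4)[OF that] by simp
  qed
  then show ?thesis by simp
qed

lemma eig_sum_Int:
  assumes S: "finite S" and z: "z \<notin> S" "\<And>w. w \<in> S \<Longrightarrow> cmod w = 1"
  shows "eig z \<inter> eig_sum S = {0}"
proof -
  have "y = 0" if y: "y \<in> eig z" "y \<in> eig_sum S" for y
  proof -
    obtain v where v: "y = (\<Sum>z\<in>S. v z)" "\<And>z. z \<in> S \<Longrightarrow> v z \<in> eig z"
      using y(2) by (auto simp: eig_sum_def)
    have "y \<bullet> y = (\<Sum>w\<in>S. v w \<bullet> y)" by (subst (1) v(1)) (simp add: inner_sum_left)
    also have "\<dots> = 0"
      using eig_orthogonal[OF v(2) y(1)] z by (intro sum.neutral) blast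
    finally show ?thesis by simp
  qed
  then show ?thesis
    using C.subspace_0[OF subspace_eig] C.subspace_0[OF subspace_eig_sum[OF S]] by blast
qed

end

section \<open>Counting eigenvalues on one side of a line\<close>

lemma invertible_op_iff:
  "invertible_op T \<longleftrightarrow> (\<exists>S. bounded_linear S \<and> (\<forall>x. S (T x) = x) \<and> (\<forall>x. T (S x) = x))"
  by (simp add: invertible_op_def fun_eq_iff)

context complex_isometry
begin

definition eigenvalues :: "complex set" where
  "eigenvalues = {z. eig z \<noteq> {0}}"

definition finitely_diagonal :: bool where
  "finitely_diagonal \<longleftrightarrow> finite eigenvalues \<and>
     (\<forall>z\<in>eigenvalues. \<exists>B. finite B \<and> C.span B = eig z) \<and> eig_sum eigenvalues = UNIV"

lemma eigenvalues_unit: "z \<in> eigenvalues \<Longrightarrow> cmod z = 1"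
  by (simp add: eigenvalues_def eigenvalue_unit)

lemma bounded_below_if_invertible:
  assumes "invertible_op (\<lambda>x. W x - w \<odot> x)"
  shows "bounded_below (\<lambda>x. W x - w \<odot> x)"
proof -
  obtain S where S: "bounded_linear S" "\<And>x. S (W x - w \<odot> x) = x"
    using assms unfolding invertible_op_iff by blast
  obtain K where K: "K > 0" "\<And>y. norm (S y) \<le> norm y * K" using bounded_linear.pos_bounded[OF S(1)] by auto
  have "norm x / K \<le> norm (W x - w \<odot> x)" for x
  proof -
    have "norm x \<le> norm (W x - w \<odot> x) * K" using K(2) S(2) by metis
    then show ?thesis using K(1) by (simp add: divide_le_eq)
  qed
  then show ?thesis unfolding bounded_below_def using K(1) by (intro exI[of _ "1 / K"]) auto
qed

lemma eig_trivial_if_bounded_below: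
  assumes "bounded_below (\<lambda>x. W x - w \<odot> x)"
  shows "eig w = {0}"
proof -
  obtain c where c: "c > 0" "\<And>x. c * norm x \<le> norm (W x - w \<odot> x)"
    using assms by (auto simp: bounded_below_def)
  have "x = 0" if "x \<in> eig w" for x
    using c(2)[of x] c(1) that by (simp add: eig_iff mult_le_0_iff)
  then show ?thesis using C.subspace_0[OF subspace_eig] by blast
qed

lemma eig_sum_mono_trivial:
  assumes "finite S" "A \<subseteq> S" "\<And>z. z \<in> S - A \<Longrightarrow> eig z = {0}"
  shows "eig_sum S \<subseteq> eig_sum A"
proof
  fix x assume "x \<in> eig_sum S"
  then obtain v where v: "x = (\<Sum>z\<in>S. v z)" "\<forall>z\<in>S. v z \<in> eig z" by (auto simp: eig_sum_def)
  have "x = (\<Sum>z\<in>A. v z)"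
    unfolding v(1) using assms v(2) by (intro sum.mono_neutral_right) auto
  then show "x \<in> eig_sum A" using v(2) assms(2) by (auto simp: eig_sum_def)
qed

text \<open>The point \<open>1\<close> is added to the spectrum only to have a nonempty set of roots; its eigenspace may be
  trivial.\<close>

lemma finitely_diagonal_if_finite_spectrum:
  assumes S: "finite S" and inv: "\<And>w. cmod w = 1 \<Longrightarrow> w \<notin> S \<Longrightarrow> invertible_op (\<lambda>x. W x - w \<odot> x)"
    and fin: "\<And>z. z \<in> S \<Longrightarrow> \<exists>B. finite B \<and> C.span B = eig z"
  shows "finitely_diagonal"
proof -
  have sub: "eigenvalues \<subseteq> S"
  proof
    fix z assume z: "z \<in> eigenvalues"
    show "z \<in> S"
    proof (rule ccontr)
      assume "z \<notin> S"
      then have "eig z = {0}"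
        using inv[OF eigenvalues_unit[OF z]]
        by (intro eig_trivial_if_bounded_below bounded_below_if_invertible)
      then show False using z by (simp add: eigenvalues_def)
    qed
  qed
  define S' where "S' = insert 1 {z\<in>S. cmod z = 1}"
  have S': "finite S'" "S' \<noteq> {}" "\<And>z. z \<in> S' \<Longrightarrow> cmod z = 1"
    using S by (auto simp: S'_def)
  have sub': "eigenvalues \<subseteq> S'"
    using sub eigenvalues_unit unfolding S'_def by blast
  have "x \<in> eig_sum S'" for x
  proof (rule eig_sum_if_ann[OF S'(1) ann_eq_0[OF S']])
    fix w assume "cmod w = 1" "w \<notin> S'"
    then show "bounded_below (\<lambda>x. W x - w \<odot> x)"
      by (intro bounded_below_if_invertible inv) (auto simp: S'_def)
  qed
  then have "eig_sum eigenvalues = UNIV"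
    using eig_sum_mono_trivial[OF S'(1) sub'] by (auto simp: eigenvalues_def)
  then show ?thesis
    unfolding finitely_diagonal_def using S sub fin finite_subset by blast
qed

lemma finite_spanning_set:
  assumes "finitely_diagonal"
  shows "\<exists>B. finite B \<and> C.span B = UNIV"
proof -
  obtain B where B: "\<And>z. z \<in> eigenvalues \<Longrightarrow> finite (B z) \<and> C.span (B z) = eig z"
    using assms unfolding finitely_diagonal_def by metis
  have "x \<in> C.span (\<Union>z\<in>eigenvalues. B z)" for x
  proof -
    have "x \<in> eig_sum eigenvalues" using assms by (auto simp: finitely_diagonal_def)
    then obtain v where v: "x = (\<Sum>z\<in>eigenvalues. v z)" "\<forall>z\<in>eigenvalues. v z \<in> eig z"
      by (auto simp: eig_sum_def)
    show ?thesis unfolding v(1)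
    proof (rule C.span_sum)
      fix z assume "z \<in> eigenvalues"
      then have "v z \<in> C.span (B z)" using v(2) B by blast
      then show "v z \<in> C.span (\<Union>z\<in>eigenvalues. B z)"
        using C.span_mono[of "B z" "\<Union>z\<in>eigenvalues. B z"] \<open>z \<in> eigenvalues\<close> by blast
    qed
  qed
  moreover have "finite (\<Union>z\<in>eigenvalues. B z)"
    using assms B by (auto simp: finitely_diagonal_def)
  ultimately show ?thesis by blast
qed

text \<open>The number of eigenvalues in \<open>A\<close>, counted with multiplicity.\<close>

definition mult_sum :: "complex set \<Rightarrow> nat" where
  "mult_sum A = (\<Sum>z\<in>eigenvalues \<inter> A. C.dim (eig z))"

end

lemma (in symplectic_space) finite_dimensional_if_spanned:
  assumes "finite B" "C.span B = UNIV"
  obtains Bs where "finite_dimensional_vector_space (jscale J) Bs"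
proof -
  obtain Bs where "Bs \<subseteq> B" "C.independent Bs" "B \<subseteq> C.span Bs"
    using C.maximal_independent_subset[of B] by metis
  moreover from this have "C.span Bs = UNIV"
    using assms(2) C.span_mono[of B "C.span Bs"] C.span_span by auto
  moreover have "finite Bs" using assms(1) \<open>Bs \<subseteq> B\<close> finite_subset by blast
  ultimately have "finite_dimensional_vector_space (jscale J) Bs"
    by unfold_locales auto
  then show thesis by (rule that)
qed

context complex_isometry
begin

lemma dim_eig_sum:
  assumes "finite_dimensional_vector_space (jscale J) Bs"
    and "finite S" "\<And>z. z \<in> S \<Longrightarrow> cmod z = 1"
  shows "C.dim (eig_sum S) = (\<Sum>z\<in>S. C.dim (eig z))"
proof -
  interpret F: finite_dimensional_vector_space "jscale J" Bs by (rule assms(1))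
  show ?thesis
    using assms(2,3)
  proof (induction S rule: finite_induct)
    case empty
    then show ?case by (simp add: eig_sum_empty F.dim_eq_0)
  next
    case (insert z S)
    have "C.dim {x + y |x y. x \<in> eig z \<and> y \<in> eig_sum S} + C.dim (eig z \<inter> eig_sum S)
        = C.dim (eig z) + C.dim (eig_sum S)"
      by (rule F.dim_sums_Int[OF subspace_eig subspace_eig_sum[OF insert.hyps(1)]])
    moreover have "eig z \<inter> eig_sum S = {0}"
      using insert.prems by (intro eig_sum_Int insert.hyps) auto
    ultimately show ?case
      using insert by (simp add: eig_sum_insert F.dim_eq_0)
  qed
qed

lemma mult_sum_eq_dim:
  assumes "finite_dimensional_vector_space (jscale J) Bs" "finitely_diagonal"
  shows "mult_sum A = C.dim (eig_sum (eigenvalues \<inter> A))"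
  unfolding mult_sum_def
  using dim_eig_sum[OF assms(1), of "eigenvalues \<inter> A"] assms(2) eigenvalues_unit
  by (auto simp: finitely_diagonal_def)

lemma mult_sum_disjoint:
  assumes "finitely_diagonal" "A \<inter> B = {}"
  shows "mult_sum (A \<union> B) = mult_sum A + mult_sum B"
  unfolding mult_sum_def Int_Un_distrib
  using assms by (intro sum.union_disjoint) (auto simp: finitely_diagonal_def)

lemma mult_sum_complement:
  assumes "finite_dimensional_vector_space (jscale J) Bs" "finitely_diagonal"
  shows "mult_sum A + mult_sum (- A) = C.dim UNIV"
  using mult_sum_disjoint[OF assms(2), of A "- A"] mult_sum_eq_dim[OF assms, of UNIV] assms(2)
  by (simp add: finitely_diagonal_def)

end

locale two_isometries = V: complex_isometry \<omega> J V + W: complex_isometry \<omega> J W for \<omega> J V W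
begin

text \<open>The quadratic form \<open>x \<mapsto> V x \<bullet> c x\<close> is at least \<open>k + g\<close> times the squared norm on the eigenvectors of \<open>V\<close>
  in \<open>A\<close>, while the form of \<open>W\<close> is at most \<open>k\<close> times it on the eigenvectors of \<open>W\<close> outside \<open>A'\<close>.
  As the forms differ by at most \<open>d\<close> times it and \<open>d < g\<close>, the two subspaces meet trivially, and a
  count of dimensions
  gives the inequality.\<close>

lemma mult_sum_le:
  assumes F: "finite_dimensional_vector_space (jscale J) Bs"
    and fd: "V.finitely_diagonal" "W.finitely_diagonal"
    and margin: "\<And>z. z \<in> V.eigenvalues \<inter> A \<Longrightarrow> k + g \<le> Re (z * cnj c)"
    and other: "\<And>z. z \<in> W.eigenvalues - A' \<Longrightarrow> Re (z * cnj c) \<le> k"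
    and close: "\<And>x. norm (V x - W x) \<le> d * norm x" and d: "d < g" and c: "cmod c = 1"
  shows "V.mult_sum A \<le> W.mult_sum A'"
proof -
  interpret F: finite_dimensional_vector_space "jscale J" Bs by (rule F)
  define E where "E = V.eig_sum (V.eigenvalues \<inter> A)"
  define G where "G = W.eig_sum (W.eigenvalues - A')"
  have fin: "finite (V.eigenvalues \<inter> A)" "finite (W.eigenvalues - A')"
    using fd by (auto simp: V.finitely_diagonal_def W.finitely_diagonal_def)
  have sub: "V.C.subspace E" "V.C.subspace G"
    unfolding E_def G_def by (intro V.subspace_eig_sum W.subspace_eig_sum fin)+
  have "x = 0" if x: "x \<in> E" "x \<in> G" for x
  proof (rule ccontr)
    assume "x \<noteq> 0"
    have "(k + g) * (norm x)\<^sup>2 \<le> V x \<bullet> jscale J c x"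
      using V.eig_sum_form_ge[OF fin(1) _ x(1)[unfolded E_def] margin] V.eigenvalues_unit by blast
    moreover have "W x \<bullet> jscale J c x \<le> k * (norm x)\<^sup>2"
      using W.eig_sum_form_le[OF fin(2) _ x(2)[unfolded G_def] other] W.eigenvalues_unit by blast
    moreover have "(V x - W x) \<bullet> jscale J c x \<le> d * (norm x)\<^sup>2"
    proof -
      have "(V x - W x) \<bullet> jscale J c x \<le> norm (V x - W x) * norm (jscale J c x)"
        by (rule norm_cauchy_schwarz)
      also have "\<dots> \<le> (d * norm x) * norm x"
        using close[of x] by (simp add: V.norm_cscale c mult_right_mono)
      finally show ?thesis by (simp add: power2_eq_square)
    qed
    ultimately have "(g - d) * (norm x)\<^sup>2 \<le> 0" by (simp add: inner_diff_left algebra_simps)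
    then show False using d \<open>x \<noteq> 0\<close> by (simp add: mult_le_0_iff)
  qed
  then have "E \<inter> G = {0}" using V.C.subspace_0 sub by blast
  moreover have "V.C.dim {x + y |x y. x \<in> E \<and> y \<in> G} + V.C.dim (E \<inter> G) = V.C.dim E + V.C.dim G"
    by (rule F.dim_sums_Int[OF sub])
  moreover have "V.C.dim {x + y |x y. x \<in> E \<and> y \<in> G} \<le> V.C.dim (UNIV :: 'a set)"
    by (rule F.dim_subset) simp
  moreover have "W.mult_sum A' + W.mult_sum (- A') = V.C.dim (UNIV :: 'a set)"
    by (rule W.mult_sum_complement[OF F fd(2)])
  moreover have "V.C.dim E = V.mult_sum A"
    unfolding E_def by (rule V.mult_sum_eq_dim[OF F fd(1), symmetric])
  moreover have "V.C.dim G = W.mult_sum (- A')"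
    unfolding G_def by (simp add: W.mult_sum_eq_dim[OF F fd(2)] Diff_eq)
  ultimately show ?thesis by (simp add: F.dim_eq_0)
qed

text \<open>The eigenvalues on either side of a line that \<open>V\<close> avoids can only move to the same side under a small
  perturbation, and the total number is the dimension of the space; so neither side gains or loses.\<close>

lemma mult_sum_half_plane_eq:
  assumes fd: "V.finitely_diagonal" "W.finitely_diagonal"
    and margin: "\<And>z. z \<in> V.eigenvalues \<Longrightarrow> g \<le> \<bar>Re (z * cnj c) - k\<bar>"
    and close: "\<And>x. norm (V x - W x) \<le> d * norm x" and d: "d < g" and c: "cmod c = 1"
    and g: "g > 0"
  shows "W.mult_sum {z. k \<le> Re (z * cnj c)} = V.mult_sum {z. k \<le> Re (z * cnj c)}"
proof -
  define A where "A = {z. k \<le> Re (z * cnj c)}"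
  obtain B where "finite B" "V.C.span B = UNIV" using V.finite_spanning_set[OF fd(1)] by metis
  then obtain Bs where F: "finite_dimensional_vector_space (jscale J) Bs"
    using V.finite_dimensional_if_spanned by metis
  have "V.mult_sum A \<le> W.mult_sum A"
  proof (rule mult_sum_le[OF F fd _ _ close d c])
    show "k + g \<le> Re (z * cnj c)" if "z \<in> V.eigenvalues \<inter> A" for z
      using margin[of z] that unfolding A_def by (simp del: times_complex.sel)
    show "Re (z * cnj c) \<le> k" if "z \<in> W.eigenvalues - A" for z
      using that unfolding A_def by (simp del: times_complex.sel)
  qed
  moreover have "V.mult_sum (- A) \<le> W.mult_sum (- A)"
  proof (rule mult_sum_le[OF F fd _ _ close d])
    show "- k + g \<le> Re (z * cnj (- c))" if "z \<in> V.eigenvalues \<inter> - A" for z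
    proof -
      have "Re (z * cnj c) < k" using that unfolding A_def by (simp del: times_complex.sel)
      then show ?thesis using margin[of z] that by (simp del: times_complex.sel)
    qed
    show "Re (z * cnj (- c)) \<le> - k" if "z \<in> W.eigenvalues - (- A)" for z
      using that unfolding A_def by (simp del: times_complex.sel)
    show "cmod (- c) = 1" using c by simp
  qed
  ultimately show ?thesis
    using V.mult_sum_complement[OF F fd(1), of A] W.mult_sum_complement[OF F fd(2), of A]
    unfolding A_def by linarith
qed

end

section \<open>Maslov partitions as chains of steps\<close>

text \<open>The sums over partitions of the interval from \<open>a\<close> that take on each subinterval a summand admitted by
  \<open>R\<close>.  In this form concatenation and refinement of partitions are inductions without indices.\<close>

inductive chain :: "(real \<Rightarrow> real \<Rightarrow> int \<Rightarrow> bool) \<Rightarrow> real \<Rightarrow> real \<Rightarrow> int \<Rightarrow> bool" for R a where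
  chain_refl: "chain R a a 0"
| chain_snoc: "chain R a b m \<Longrightarrow> b < c \<Longrightarrow> R b c k \<Longrightarrow> chain R a c (m + k)"

lemma chain_single: "a < b \<Longrightarrow> R a b k \<Longrightarrow> chain R a b k"
  using chain_snoc[OF chain_refl, of a b R k] by simp

lemma chain_le: "chain R a b m \<Longrightarrow> a \<le> b"
  by (induction rule: chain.induct) auto

lemma chain_trans:
  assumes "chain R b c k" "chain R a b m"
  shows "chain R a c (m + k)"
  using assms
proof (induction arbitrary: m rule: chain.induct)
  case (chain_snoc b' k' c k'')
  then show ?case using chain.chain_snoc by (metis add.assoc)
qed simp

lemma chain_refine:
  assumes "chain R a c m" "A \<le> a" "c \<le> B"
    and "\<And>b c k. A \<le> b \<Longrightarrow> b < c \<Longrightarrow> c \<le> B \<Longrightarrow> R b c k \<Longrightarrow> chain R' b c k"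
  shows "chain R' a c m"
  using assms(1-3)
proof (induction rule: chain.induct)
  case (chain_snoc b m c k)
  then have "A \<le> b" using chain_le by fastforce
  then show ?case
    using chain_snoc assms(4)[of b c k] chain_trans[of R' b c k a m] by auto
qed (rule chain_refl)

lemma chain_iff_partition:
  "chain R a c m \<longleftrightarrow> (\<exists>(N::nat) t k. t 0 = a \<and> t N = c \<and>
     (\<forall>j\<in>{1..N}. t (j - 1) < t j \<and> R (t (j - 1)) (t j) (k j)) \<and> m = (\<Sum>j=1..N. k j))"
  (is "_ \<longleftrightarrow> (\<exists>N t k. ?P N t k c m)")
proof
  assume "chain R a c m"
  then show "\<exists>N t k. ?P N t k c m"
  proof (induction rule: chain.induct)
    case chain_refl
    show ?case
      by (rule exI[of _ 0], rule exI[of _ "\<lambda>_. a"], rule exI[of _ "\<lambda>_. 0"]) simp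
  next
    case (chain_snoc b m c k)
    from chain_snoc.IH obtain N t k' where "?P N t k' b m" by blast
    then have P: "t 0 = a" "t N = b"
      "\<And>j. j \<in> {1..N} \<Longrightarrow> t (j - 1) < t j \<and> R (t (j - 1)) (t j) (k' j)" "m = (\<Sum>j=1..N. k' j)"
      by blast+
    define t' where "t' = t(Suc N := c)"
    define k'' where "k'' = k'(Suc N := k)"
    have "t' (j - 1) < t' j \<and> R (t' (j - 1)) (t' j) (k'' j)" if "j \<in> {1..Suc N}" for j
    proof (cases "j = Suc N")
      case True
      then show ?thesis using P(2) chain_snoc by (simp add: t'_def k''_def)
    next
      case False
      then have "j \<in> {1..N}" "j - 1 \<noteq> Suc N" using that by auto
      then show ?thesis using P(3)[of j] False by (simp add: t'_def k''_def)
    qed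
    moreover have "m + k = (\<Sum>j=1..Suc N. k'' j)"
      using P(4) by (simp add: k''_def)
    moreover have "t' 0 = a" "t' (Suc N) = c" using P by (auto simp: t'_def)
    ultimately show ?case by blast
  qed
next
  assume "\<exists>N t k. ?P N t k c m"
  then obtain N t k where "?P N t k c m" by blast
  then show "chain R a c m"
  proof (induction N arbitrary: c m)
    case 0
    then have "c = a" "m = 0" by auto
    then show ?case by (simp add: chain_refl)
  next
    case (Suc N)
    have "chain R a (t N) (\<Sum>j=1..N. k j)" using Suc.prems by (intro Suc.IH) auto
    moreover have "t N < t (Suc N) \<and> R (t N) (t (Suc N)) (k (Suc N))"
      using Suc.prems by (metis Suc_leI atLeastAtMost_iff diff_Suc_1 le_refl zero_less_Suc One_nat_def)
    ultimately show ?case using Suc.prems chain_snoc by force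
  qed
qed

text \<open>The condition that a partition imposes on the operator at a single time.\<close>

definition arc_admissible :: "('a \<Rightarrow> 'a) \<Rightarrow> ('a::real_normed_vector \<Rightarrow> 'a) \<Rightarrow> real \<Rightarrow> bool" where
  "arc_admissible J W e \<longleftrightarrow>
     invertible_op (\<lambda>x. W x - jscale J (cis (pi + e)) x) \<and>
     finite (spectrum_op J W \<inter> {cis (pi + \<theta>) |\<theta>. \<bar>\<theta>\<bar> \<le> e}) \<and>
     (\<forall>z\<in>spectrum_op J W \<inter> {cis (pi + \<theta>) |\<theta>. \<bar>\<theta>\<bar> \<le> e}. eigenspace J W z \<noteq> {0} \<and>
        (\<exists>B. finite B \<and> module.span (jscale J) B = eigenspace J W z))"

definition maslov_step ::
    "('a \<Rightarrow> 'a) \<Rightarrow> (real \<Rightarrow> 'a::real_normed_vector \<Rightarrow> 'a) \<Rightarrow> real \<Rightarrow> real \<Rightarrow> int \<Rightarrow> bool" where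
  "maslov_step J W a b k \<longleftrightarrow> (\<exists>e. 0 < e \<and> e < pi \<and> (\<forall>s\<in>{a..b}. arc_admissible J (W s) e) \<and>
     k = int (maslov_count J (W b) e) - int (maslov_count J (W a) e))"

lemma maslov_partition_iff:
  "maslov_partition J W N t \<epsilon> \<longleftrightarrow> t 0 = 0 \<and> t N = 1 \<and>
     (\<forall>j\<in>{1..N}. t (j - 1) < t j \<and> 0 < \<epsilon> j \<and> \<epsilon> j < pi \<and>
       (\<forall>s\<in>{t (j - 1)..t j}. arc_admissible J (W s) (\<epsilon> j)))"
  by (simp only: maslov_partition_def arc_admissible_def Let_def)

lemma maslov_M_chain: "maslov_M J W = (THE m. chain (maslov_step J W) 0 1 m)"
proof -
  have "(\<exists>N t \<epsilon>. maslov_partition J W N t \<epsilon> \<and>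
      m = (\<Sum>j=1..N. int (maslov_count J (W (t j)) (\<epsilon> j)) - int (maslov_count J (W (t (j - 1))) (\<epsilon> j))))
    \<longleftrightarrow> chain (maslov_step J W) 0 1 m" (is "?L \<longleftrightarrow> ?R") for m
  proof
    assume ?L
    then obtain N t \<epsilon> where P: "maslov_partition J W N t \<epsilon>"
      "m = (\<Sum>j=1..N. int (maslov_count J (W (t j)) (\<epsilon> j)) - int (maslov_count J (W (t (j - 1))) (\<epsilon> j)))"
      by blast
    have "t (j - 1) < t j \<and> maslov_step J W (t (j - 1)) (t j)
        (int (maslov_count J (W (t j)) (\<epsilon> j)) - int (maslov_count J (W (t (j - 1))) (\<epsilon> j)))"
      if "j \<in> {1..N}" for j
      using P(1) that unfolding maslov_partition_iff maslov_step_def by blast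
    moreover have "t 0 = 0" "t N = 1" using P(1) by (auto simp: maslov_partition_def)
    ultimately show ?R unfolding chain_iff_partition using P(2)
      by (intro exI[of _ N] exI[of _ t]
          exI[of _ "\<lambda>j. int (maslov_count J (W (t j)) (\<epsilon> j)) - int (maslov_count J (W (t (j - 1))) (\<epsilon> j))"])
        auto
  next
    assume ?R
    then obtain N :: nat and t k where "t 0 = 0 \<and> t N = 1 \<and>
        (\<forall>j\<in>{1..N}. t (j - 1) < t j \<and> maslov_step J W (t (j - 1)) (t j) (k j)) \<and> m = (\<Sum>j=1..N. k j)"
      unfolding chain_iff_partition by blast
    then have P: "t 0 = 0" "t N = 1"
      "\<And>j. j \<in> {1..N} \<Longrightarrow> t (j - 1) < t j \<and> maslov_step J W (t (j - 1)) (t j) (k j)" "m = (\<Sum>j=1..N. k j)"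
      by blast+
    then have "\<forall>j\<in>{1..N}. \<exists>e. 0 < e \<and> e < pi \<and> (\<forall>s\<in>{t (j - 1)..t j}. arc_admissible J (W s) e) \<and>
        k j = int (maslov_count J (W (t j)) e) - int (maslov_count J (W (t (j - 1))) e)"
      unfolding maslov_step_def by blast
    then obtain \<epsilon> where \<epsilon>: "\<And>j. j \<in> {1..N} \<Longrightarrow> 0 < \<epsilon> j \<and> \<epsilon> j < pi \<and>
        (\<forall>s\<in>{t (j - 1)..t j}. arc_admissible J (W s) (\<epsilon> j)) \<and>
        k j = int (maslov_count J (W (t j)) (\<epsilon> j)) - int (maslov_count J (W (t (j - 1))) (\<epsilon> j))"
      by metis
    then have "maslov_partition J W N t \<epsilon>"
      using P(1-3) unfolding maslov_partition_iff by blast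
    moreover have "m = (\<Sum>j=1..N. int (maslov_count J (W (t j)) (\<epsilon> j)) - int (maslov_count J (W (t (j - 1))) (\<epsilon> j)))"
      unfolding P(4) using \<epsilon> by (intro sum.cong) auto
    ultimately show ?L by blast
  qed
  then show ?thesis by (simp add: maslov_M_def)
qed

section \<open>Arcs of the unit circle\<close>

lemma cis_pi_add: "cis (pi + a) = - cis a"
  by (simp add: cis.ctr complex_eq_iff)

lemma cis_pi_add_eq_iff:
  assumes "0 \<le> a" "a < 2 * pi" "0 \<le> b" "b < 2 * pi"
  shows "cis (pi + a) = cis (pi + b) \<longleftrightarrow> a = b"
proof
  assume "cis (pi + a) = cis (pi + b)"
  then have "sin a = sin b \<and> cos a = cos b" by (simp add: cis_pi_add complex_eq_iff)
  then obtain n :: int where n: "a = b + 2 * pi * n" using sin_cos_eq_iff by blast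
  have "\<bar>2 * pi * real_of_int n\<bar> < 2 * pi" using n assms by linarith
  then have "\<bar>real_of_int n\<bar> < 1" by (simp add: abs_mult)
  then have "n = 0" by linarith
  then show "a = b" using n by simp
qed simp

lemma unit_eq_cis_pi_add:
  assumes "cmod z = 1"
  obtains t where "z = cis (pi + t)" "0 \<le> t" "t < 2 * pi"
proof -
  have z: "z \<noteq> 0" using assms by auto
  have "z = - cis (Arg (- z))" using assms cis_Arg[of "- z"] z by (simp add: sgn_eq)
  then have e: "z = cis (pi + Arg (- z))" by (simp add: cis_pi_add)
  show thesis
  proof (cases "Arg (- z) \<ge> 0")
    case True
    then show thesis using that[OF e] Arg_bounded[of "- z"] pi_gt_zero by linarith
  next
    case False
    have "cis (pi + (Arg (- z) + 2 * pi)) = cis (pi + Arg (- z))"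
      by (simp only: cis_pi_add) (simp add: complex_eq_iff)
    then show thesis using that[of "Arg (- z) + 2 * pi"] e False Arg_bounded[of "- z"] by simp
  qed
qed

lemma Re_cis_mult_cnj: "Re (cis (pi + t) * cnj (cis (pi + m))) = cos (t - m)"
  by (simp add: cis_pi_add cos_diff)

text \<open>An arc of the circle is cut out by a line: with \<open>m\<close> the midpoint and \<open>h\<close> half the length of the arc
  from \<open>e\<close> to \<open>b\<close>, the points of angle \<open>t\<close> in its interior are those with \<open>cos (t - m) > cos h\<close>.\<close>

lemma cos_arc:
  assumes e: "0 < e" "e < b" "b < 2 * pi" and t: "0 \<le> t" "t < 2 * pi"
  shows "e < t \<Longrightarrow> t < b \<Longrightarrow> cos ((b - e) / 2) < cos (t - (e + b) / 2)"
    and "t < e \<or> b < t \<Longrightarrow> cos (t - (e + b) / 2) < cos ((b - e) / 2)"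
proof -
  define m where "m = (e + b) / 2"
  define h where "h = (b - e) / 2"
  have eb: "e = m - h" "b = m + h" by (simp_all add: m_def h_def field_simps)
  have h: "0 < h" "h < pi" using e by (simp_all add: h_def)
  have c: "cos (t - m) = cos \<bar>t - m\<bar>" by simp
  show "cos h < cos (t - m)" if "e < t" "t < b"
    unfolding c using that eb h by (intro cos_monotone_0_pi) auto
  show "cos (t - m) < cos h" if "t < e \<or> b < t"
  proof (cases "\<bar>t - m\<bar> \<le> pi")
    case True
    then show ?thesis unfolding c using that eb h by (intro cos_monotone_0_pi) auto
  next
    case False
    have "cos \<bar>t - m\<bar> = cos (2 * pi - \<bar>t - m\<bar>)" by (simp add: cos_diff)
    also have "\<dots> < cos h" using False eb e t h by (intro cos_monotone_0_pi) (auto simp: abs_if split: if_splits)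
    finally show ?thesis unfolding c .
  qed
qed

context complex_isometry
begin

lemma maslov_count_eq_mult_sum:
  assumes b: "b < 2 * pi"
  shows "maslov_count J W b = mult_sum {cis (pi + t) |t. 0 \<le> t \<and> t \<le> b}"
proof -
  define T where "T = {t. 0 \<le> t \<and> t \<le> b \<and> eig (cis (pi + t)) \<noteq> {0}}"
  have inj: "inj_on (\<lambda>t. cis (pi + t)) T"
    using b cis_pi_add_eq_iff by (auto simp: inj_on_def T_def)
  have "maslov_count J W b = (\<Sum>t\<in>T. C.dim (eig (cis (pi + t))))"
    by (simp add: maslov_count_def T_def)
  also have "\<dots> = (\<Sum>z\<in>(\<lambda>t. cis (pi + t)) ` T. C.dim (eig z))"
    by (simp add: sum.reindex[OF inj])
  also have "(\<lambda>t. cis (pi + t)) ` T = eigenvalues \<inter> {cis (pi + t) |t. 0 \<le> t \<and> t \<le> b}"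
    by (auto simp: T_def eigenvalues_def)
  finally show ?thesis by (simp add: mult_sum_def)
qed

lemma maslov_count_diff:
  assumes fd: "finitely_diagonal" and e: "0 < e" "e < b" "b < 2 * pi"
    and end_points: "cis (pi + e) \<notin> eigenvalues" "cis (pi + b) \<notin> eigenvalues"
  shows "maslov_count J W b = maslov_count J W e +
    mult_sum {z. cos ((b - e) / 2) \<le> Re (z * cnj (cis (pi + (e + b) / 2)))}"
proof -
  define A where "A = {cis (pi + t) |t. 0 \<le> t \<and> t \<le> e}"
  define B where "B = {cis (pi + t) |t. e < t \<and> t \<le> b}"
  define H where "H = {z. cos ((b - e) / 2) \<le> Re (z * cnj (cis (pi + (e + b) / 2)))}"
  have "{cis (pi + t) |t. 0 \<le> t \<and> t \<le> b} = A \<union> B"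
    unfolding A_def B_def using e by (force simp: not_le)
  moreover have "A \<inter> B = {}"
    unfolding A_def B_def using e by (auto simp: cis_pi_add_eq_iff)
  ultimately have "maslov_count J W b = mult_sum A + mult_sum B"
    using maslov_count_eq_mult_sum[OF e(3)] mult_sum_disjoint[OF fd] by simp
  moreover have "mult_sum A = maslov_count J W e"
    unfolding A_def using e by (intro maslov_count_eq_mult_sum[symmetric]) simp
  moreover have "eigenvalues \<inter> B = eigenvalues \<inter> H"
  proof -
    have "z \<in> B \<longleftrightarrow> z \<in> H" if z: "z \<in> eigenvalues" for z
    proof -
      obtain t where t: "z = cis (pi + t)" "0 \<le> t" "t < 2 * pi"
        using unit_eq_cis_pi_add[OF eigenvalues_unit[OF z]] by metis
      have ne: "t \<noteq> e" "t \<noteq> b" using z t(1) end_points by auto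
      have "z \<in> B \<longleftrightarrow> e < t \<and> t \<le> b"
        unfolding B_def t(1) using e t by (auto simp: cis_pi_add_eq_iff)
      also have "\<dots> \<longleftrightarrow> z \<in> H"
        unfolding H_def mem_Collect_eq t(1) Re_cis_mult_cnj
        using cos_arc[OF e t(2,3)] ne by (meson linorder_not_less less_le not_less_iff_gr_or_eq)
      finally show ?thesis .
    qed
    then show ?thesis by blast
  qed
  ultimately show ?thesis unfolding mult_sum_def H_def by simp
qed

text \<open>For \<open>b\<close> at least \<open>pi\<close> the arc of angles between \<open>- b\<close> and \<open>b\<close> is the whole circle, so that
  admissibility concerns the full spectrum.\<close>

lemma long_arc_facts:
  assumes adm: "arc_admissible J W b" and b: "pi \<le> b"
  shows "finitely_diagonal" "cis (pi + b) \<notin> eigenvalues"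
    and "cmod w = 1 \<Longrightarrow> w \<notin> eigenvalues \<Longrightarrow> invertible_op (\<lambda>x. W x - w \<odot> x)"
    and "e \<le> b \<Longrightarrow> invertible_op (\<lambda>x. W x - cis (pi + e) \<odot> x) \<Longrightarrow> arc_admissible J W e"
proof -
  define A where "A = spectrum_op J W \<inter> {cis (pi + \<theta>) |\<theta>. \<bar>\<theta>\<bar> \<le> b}"
  have A: "finite A" "\<And>z. z \<in> A \<Longrightarrow> eig z \<noteq> {0} \<and> (\<exists>B. finite B \<and> C.span B = eig z)"
    and inv_b: "invertible_op (\<lambda>x. W x - cis (pi + b) \<odot> x)"
    using adm unfolding arc_admissible_def A_def by auto
  have arc: "w \<in> {cis (pi + \<theta>) |\<theta>. \<bar>\<theta>\<bar> \<le> b}" if "cmod w = 1" for w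
  proof -
    have "- w \<noteq> 0" using that by auto
    then have "w = cis (pi + Arg (- w))" using that cis_Arg[of "- w"] by (simp add: sgn_eq cis_pi_add)
    moreover have "\<bar>Arg (- w)\<bar> \<le> b" using Arg_bounded[of "- w"] b by linarith
    ultimately show ?thesis by blast
  qed
  have inv: "invertible_op (\<lambda>x. W x - w \<odot> x)" if "cmod w = 1" "w \<notin> A" for w
    using that arc by (auto simp: A_def spectrum_op_def)
  show "finitely_diagonal"
    using A(2) by (intro finitely_diagonal_if_finite_spectrum[OF A(1) inv]) auto
  show "cis (pi + b) \<notin> eigenvalues"
    using eig_trivial_if_bounded_below[OF bounded_below_if_invertible[OF inv_b]]
    by (simp add: eigenvalues_def)
  show "invertible_op (\<lambda>x. W x - w \<odot> x)" if "cmod w = 1" "w \<notin> eigenvalues"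
    using inv[OF that(1)] A(2)[of w] that(2) by (auto simp: eigenvalues_def)
  show "arc_admissible J W e" if "e \<le> b" "invertible_op (\<lambda>x. W x - cis (pi + e) \<odot> x)"
  proof -
    have sub: "spectrum_op J W \<inter> {cis (pi + \<theta>) |\<theta>. \<bar>\<theta>\<bar> \<le> e} \<subseteq> A"
      using that(1) by (force simp: A_def)
    show ?thesis
      unfolding arc_admissible_def
    proof (intro conjI ballI)
      show "finite (spectrum_op J W \<inter> {cis (pi + \<theta>) |\<theta>. \<bar>\<theta>\<bar> \<le> e})"
        by (rule finite_subset[OF sub A(1)])
    qed (use that(2) A(2) sub in blast)+
  qed
qed

end

section \<open>Refining long arcs\<close>

text \<open>Near each time \<open>x\<close> pick \<open>e < pi\<close> whose endpoint misses the spectrum of \<open>W x\<close>.  The eigenvalues between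
  the angles \<open>e\<close> and \<open>\<beta>\<close> are cut off by a line that the spectrum of \<open>W x\<close> avoids, so their number
  is constant near \<open>x\<close> and the increments of the counts for \<open>\<beta>\<close> and for \<open>e\<close> agree there.  A
  subdivision into such short intervals exists by compactness.\<close>

lemma long_arc_chain:
  fixes W :: "real \<Rightarrow> 'a::{real_inner, complete_space} \<Rightarrow> 'a"
  assumes iso: "\<And>s. s \<in> {a..b} \<Longrightarrow> complex_isometry \<omega> J (W s)"
    and cont: "\<And>s \<eta>. s \<in> {a..b} \<Longrightarrow> 0 < \<eta> \<Longrightarrow>
      \<exists>d>0. \<forall>s'\<in>{a..b}. \<bar>s' - s\<bar> < d \<longrightarrow> (\<forall>x. norm (W s' x - W s x) \<le> \<eta> * norm x)"
    and adm: "\<And>s. s \<in> {a..b} \<Longrightarrow> arc_admissible J (W s) \<beta>"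
    and \<beta>: "pi \<le> \<beta>" "\<beta> < 2 * pi" and ab: "a \<le> b"
  shows "chain (maslov_step J W) a b (int (maslov_count J (W b) \<beta>) - int (maslov_count J (W a) \<beta>))"
proof -
  have local_arc: "\<exists>d>0. \<exists>e K. 0 < e \<and> e < pi \<and> (\<forall>s\<in>{a..b}. \<bar>s - x\<bar> < d \<longrightarrow>
      arc_admissible J (W s) e \<and> maslov_count J (W s) \<beta> = maslov_count J (W s) e + K)"
    if x: "x \<in> {a..b}" for x
  proof -
    interpret X: complex_isometry \<omega> J "W x" by (rule iso[OF x])
    note X_arc = X.long_arc_facts[OF adm[OF x] \<beta>(1)]
    have finX: "finite X.eigenvalues" using X_arc(1) by (simp add: X.finitely_diagonal_def)
    have "inj_on (\<lambda>t. cis (pi + t)) {0<..<pi}"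
      by (auto simp: inj_on_def cis_pi_add_eq_iff)
    then have "infinite ((\<lambda>t. cis (pi + t)) ` {0<..<pi})"
      by (simp add: finite_image_iff infinite_Ioo)
    then obtain e where e: "0 < e" "e < pi" "cis (pi + e) \<notin> X.eigenvalues"
      using finX finite_subset by (metis greaterThanLessThan_iff image_subsetI)
    have e\<beta>: "e < \<beta>" using e \<beta> by simp
    define c where "c = cis (pi + (e + \<beta>) / 2)"
    define \<kappa> where "\<kappa> = cos ((\<beta> - e) / 2)"
    have cmod_c: "cmod c = 1" by (simp add: c_def)
    have ne: "Re (z * cnj c) \<noteq> \<kappa>" if z: "z \<in> X.eigenvalues" for z
    proof -
      obtain t where t: "z = cis (pi + t)" "0 \<le> t" "t < 2 * pi"
        using unit_eq_cis_pi_add[OF X.eigenvalues_unit[OF z]] by metis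
      have "t \<noteq> e" "t \<noteq> \<beta>" using z t(1) e(3) X_arc(2) by auto
      then show ?thesis
        unfolding t(1) c_def \<kappa>_def Re_cis_mult_cnj
        using cos_arc[OF e(1) e\<beta> \<beta>(2) t(2,3)] by (smt (verit))
    qed
    define g where "g = Min (insert 1 ((\<lambda>z. \<bar>Re (z * cnj c) - \<kappa>\<bar>) ` X.eigenvalues))"
    have g: "g > 0" "\<And>z. z \<in> X.eigenvalues \<Longrightarrow> g \<le> \<bar>Re (z * cnj c) - \<kappa>\<bar>"
    proof -
      show "g > 0" unfolding g_def using finX ne by (subst Min_gr_iff) (auto simp del: times_complex.sel)
      show "\<And>z. z \<in> X.eigenvalues \<Longrightarrow> g \<le> \<bar>Re (z * cnj c) - \<kappa>\<bar>"
        unfolding g_def using finX by (intro Min_le) auto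
    qed
    have "X.bounded_below (\<lambda>y. W x y - jscale J (cis (pi + e)) y)"
      using e by (intro X.bounded_below_if_invertible X_arc(3)) auto
    then obtain c0 where c0: "c0 > 0" "\<And>y. c0 * norm y \<le> norm (W x y - jscale J (cis (pi + e)) y)"
      by (auto simp: X.bounded_below_def)
    define \<eta> where "\<eta> = min (g / 2) (c0 / 2)"
    have \<eta>: "\<eta> > 0" "\<eta> < g" "\<eta> < c0" using g c0 by (auto simp: \<eta>_def)
    obtain d where d: "d > 0"
      "\<And>s y. s \<in> {a..b} \<Longrightarrow> \<bar>s - x\<bar> < d \<Longrightarrow> norm (W s y - W x y) \<le> \<eta> * norm y"
      using cont[OF x \<eta>(1)] by blast
    define K where "K = X.mult_sum {z. \<kappa> \<le> Re (z * cnj c)}"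
    have "arc_admissible J (W s) e \<and> maslov_count J (W s) \<beta> = maslov_count J (W s) e + K"
      if s: "s \<in> {a..b}" "\<bar>s - x\<bar> < d" for s
    proof -
      interpret S: complex_isometry \<omega> J "W s" by (rule iso[OF s(1)])
      interpret T: two_isometries \<omega> J "W x" "W s" ..
      note S_arc = S.long_arc_facts[OF adm[OF s(1)] \<beta>(1)]
      have close: "norm (W x y - W s y) \<le> \<eta> * norm y" for y
        using d(2)[OF s, of y] by (simp add: norm_minus_commute)
      have "y = 0" if "y \<in> S.eig (cis (pi + e))" for y
      proof (rule ccontr)
        assume "y \<noteq> 0"
        have "c0 * norm y \<le> \<eta> * norm y"
          using c0(2)[of y] close[of y] that by (simp add: S.eig_iff)
        then show False using \<eta>(3) \<open>y \<noteq> 0\<close> by simp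
      qed
      then have "S.eig (cis (pi + e)) = {0}" using X.C.subspace_0[OF S.subspace_eig] by blast
      then have eS: "cis (pi + e) \<notin> S.eigenvalues" by (simp add: S.eigenvalues_def)
      have "arc_admissible J (W s) e"
        using e\<beta> eS by (intro S_arc(4) S_arc(3)) auto
      moreover have "S.mult_sum {z. \<kappa> \<le> Re (z * cnj c)} = K"
        unfolding K_def
        by (rule T.mult_sum_half_plane_eq[OF X_arc(1) S_arc(1) g(2) close \<eta>(2) cmod_c g(1)])
      moreover have "maslov_count J (W s) \<beta> = maslov_count J (W s) e + S.mult_sum {z. \<kappa> \<le> Re (z * cnj c)}"
        unfolding \<kappa>_def c_def
        by (rule S.maslov_count_diff[OF S_arc(1) e(1) e\<beta> \<beta>(2) eS S_arc(2)])
      ultimately show ?thesis by simp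
    qed
    then show ?thesis using d(1) e by blast
  qed
  define D where "D s = int (maslov_count J (W s) \<beta>)" for s
  define P where "P u v \<longleftrightarrow> (a \<le> u \<longrightarrow> v \<le> b \<longrightarrow> chain (maslov_step J W) u v (D v - D u))" for u v
  have "P a b"
  proof (rule Bolzano[OF ab])
    fix u v w assume "P u v" "P v w" "u \<le> v" "v \<le> w"
    then show "P u w"
      unfolding P_def using chain_trans[of "maslov_step J W" v w "D w - D v" u "D v - D u"] by auto
  next
    fix x assume "a \<le> x" "x \<le> b"
    then obtain d e K where dek: "d > 0" "0 < e" "e < pi" "\<And>s. s \<in> {a..b} \<Longrightarrow> \<bar>s - x\<bar> < d \<Longrightarrow>
      arc_admissible J (W s) e \<and> maslov_count J (W s) \<beta> = maslov_count J (W s) e + K"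
      using local_arc[of x] by auto
    have "chain (maslov_step J W) u v (D v - D u)"
      if uv: "u \<le> x" "x \<le> v" "v - u < d" "a \<le> u" "v \<le> b" for u v
    proof (cases "u = v")
      case False
      have near: "s \<in> {a..b}" "\<bar>s - x\<bar> < d" if "s \<in> {u..v}" for s
        using uv that by auto
      have "maslov_step J W u v (D v - D u)"
        unfolding maslov_step_def
      proof (intro exI[of _ e] conjI ballI dek)
        show "arc_admissible J (W s) e" if "s \<in> {u..v}" for s
          using dek(4)[OF near[OF that]] by blast
        show "D v - D u = int (maslov_count J (W v) e) - int (maslov_count J (W u) e)"
          using dek(4)[OF near[of u]] dek(4)[OF near[of v]] uv by (simp add: D_def)
      qed
      then show ?thesis using uv False by (intro chain_single) auto
    qed (simp add: chain_refl)
    then show "\<exists>d>0. \<forall>u v. u \<le> x \<and> x \<le> v \<and> v - u < d \<longrightarrow> P u v"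
      unfolding P_def using dek(1) by blast
  qed
  then show ?thesis by (simp add: P_def D_def)
qed

section \<open>The Souriau map of the doubled pair\<close>

lemma dim_image_injective:
  assumes f: "Vector_Spaces.linear s1 s2 f" "inj f" and E: "module.subspace s1 E"
  shows "vector_space.dim s2 (f ` E) = vector_space.dim s1 E"
proof -
  interpret f: Vector_Spaces.linear s1 s2 f by (rule f(1))
  obtain B where B: "B \<subseteq> E" "f.vs1.independent B" "E \<subseteq> f.vs1.span B" "card B = f.vs1.dim E"
    using f.vs1.basis_exists by metis
  show ?thesis
  proof (rule f.vs2.dim_unique)
    show "f ` B \<subseteq> f ` E" using B by blast
    show "f ` E \<subseteq> f.vs2.span (f ` B)" unfolding f.span_image using B(3) by blast
    show "f.vs2.independent (f ` B)"
      using f(2) B(2) by (intro f.independent_injective_image) (auto intro: inj_on_subset)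
    show "card (f ` B) = f.vs1.dim E"
      using card_image[of f B] f(2) B(4) by (auto intro: inj_on_subset)
  qed
qed

lemma finite_span_image_injective:
  assumes f: "Vector_Spaces.linear s1 s2 f" "inj f"
  shows "(\<exists>B. finite B \<and> module.span s2 B = f ` E) \<longleftrightarrow> (\<exists>B. finite B \<and> module.span s1 B = E)"
proof -
  interpret f: Vector_Spaces.linear s1 s2 f by (rule f(1))
  show ?thesis
  proof
    assume "\<exists>B. finite B \<and> module.span s2 B = f ` E"
    then obtain B where B: "finite B" "f.vs2.span B = f ` E" by auto
    have "B \<subseteq> f ` E" using f.vs2.span_superset[of B] unfolding B(2) .
    then obtain C where C: "C \<subseteq> E" "B = f ` C" by (metis subset_imageE)
    have "finite C" using B(1) C(2) f(2) by (auto intro: finite_imageD inj_on_subset)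
    moreover have "f ` f.vs1.span C = f ` E" using B(2) C(2) f.span_image by metis
    then have "f.vs1.span C = E" using f(2) by (simp add: inj_image_eq_iff)
    ultimately show "\<exists>B. finite B \<and> f.vs1.span B = E" by blast
  next
    assume "\<exists>B. finite B \<and> f.vs1.span B = E"
    then show "\<exists>B. finite B \<and> f.vs2.span B = f ` E" using f.span_image by (metis finite_imageI)
  qed
qed

lemma lagrangian_times:
  assumes "symplectic_hilbert \<omega> J" "lagrangian \<omega> M" "lagrangian \<omega> L"
  shows "lagrangian (box_form \<omega>) (M \<times> L)"
proof -
  interpret M: lagrangian_subspace \<omega> J M using assms by unfold_locales
  interpret L: lagrangian_subspace \<omega> J L using assms by unfold_locales
  have perp: "x \<in> M \<longleftrightarrow> (\<forall>y\<in>M. \<omega> x y = 0)" "x \<in> L \<longleftrightarrow> (\<forall>y\<in>L. \<omega> x y = 0)" for x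
    using assms unfolding lagrangian_def by auto
  have "p \<in> M \<times> L" if p: "\<forall>q\<in>M \<times> L. box_form \<omega> p q = 0" for p
  proof -
    have "\<forall>y\<in>M. box_form \<omega> p (y, 0) = 0" "\<forall>y\<in>L. box_form \<omega> p (0, y) = 0"
      using p subspace_0[OF M.subspace] subspace_0[OF L.subspace] by auto
    then show ?thesis
      using perp[of "fst p"] perp[of "snd p"]
      by (simp add: box_form_def M.omega_eq mem_Times_iff)
  qed
  moreover have "box_form \<omega> p q = 0" if "p \<in> M \<times> L" "q \<in> M \<times> L" for p q
    using that perp(1)[of "fst p"] perp(2)[of "snd p"] by (simp add: box_form_def mem_Times_iff)
  ultimately have "{p. \<forall>q\<in>M \<times> L. box_form \<omega> p q = 0} = M \<times> L" by blast
  moreover have "subspace (M \<times> L)"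
    using M.subspace L.subspace by (auto simp: subspace_def zero_prod_def)
  ultimately show ?thesis
    using closed_Times[OF M.closed L.closed] by (simp add: lagrangian_def)
qed

text \<open>\<open>W\<close> is the Souriau operator of \<open>M\<close> relative to \<open>L\<close>, and \<open>W\<^sub>2\<close> that of \<open>M \<times> L\<close> relative to the
  diagonal.\<close>

locale lagrangian_pair = M: lagrangian_subspace \<omega> J M + L: lagrangian_subspace \<omega> J L for \<omega> J M L
begin

abbreviation "\<sigma> \<equiv> reflection M"
abbreviation "\<tau> \<equiv> reflection L"

definition "W x = - \<sigma> (\<tau> x)"
definition "W\<^sub>2 p = (- \<sigma> (snd p), - \<tau> (fst p))"

lemma souriau_eq_W: "souriau \<omega> J L M = W"
  using souriau_eq_reflections[OF M.symplectic L.lagrangian M.lagrangian] by (simp add: W_def fun_eq_iff)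

text \<open>The reflection in the diagonal swaps the two components.\<close>

lemma souriau_box_eq_W2: "souriau (box_form \<omega>) (box_J J) diagonal (M \<times> L) = W\<^sub>2"
proof -
  note box = symplectic_hilbert_box[OF M.symplectic]
  interpret D: lagrangian_subspace "box_form \<omega>" "box_J J" diagonal
    using box lagrangian_diagonal[OF M.symplectic] by unfold_locales
  interpret P: lagrangian_subspace "box_form \<omega>" "box_J J" "M \<times> L"
    using box lagrangian_times[OF M.symplectic M.lagrangian L.lagrangian] by unfold_locales
  have "reflection diagonal (x, y) = (y, x)" for x y :: 'a
  proof -
    define u where "u = (1/2) *\<^sub>R (x + y)"
    define v where "v = (1/2) *\<^sub>R (x - y)"
    have xy: "x = u + v" "y = u - v"
      by (simp_all add: u_def v_def flip: scaleR_add_right scaleR_diff_right)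
    have "reflection diagonal ((u, u) + (v, - v)) = (u, u) - (v, - v)"
      by (rule D.reflection_eq) (auto simp: diagonal_def)
    then show ?thesis by (simp add: xy)
  qed
  moreover have "reflection (M \<times> L) (x, y) = (\<sigma> x, \<tau> y)" for x y
  proof -
    obtain p q where x: "x = p + q" "p \<in> M" "\<And>z. z \<in> M \<Longrightarrow> q \<bullet> z = 0" using M.decompose[of x] by metis
    obtain p' q' where y: "y = p' + q'" "p' \<in> L" "\<And>z. z \<in> L \<Longrightarrow> q' \<bullet> z = 0" using L.decompose[of y] by metis
    have "reflection (M \<times> L) ((p, p') + (q, q')) = (p, p') - (q, q')"
      by (rule P.reflection_eq) (use x y in auto)
    then show ?thesis using M.reflection_eq[OF x(2,3)] L.reflection_eq[OF y(2,3)] by (simp add: x(1) y(1))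
  qed
  ultimately show ?thesis
    using souriau_eq_reflections[OF box D.lagrangian P.lagrangian]
    by (auto simp: fun_eq_iff W\<^sub>2_def)
qed

lemma jscale_box: "jscale (box_J J) z (x, y) = (jscale J z x, jscale J (cnj z) y)"
  by (simp add: jscale_def box_J_def)

lemmas \<tau>_linear = linear_0[OF L.linear_reflection] linear_add[OF L.linear_reflection]
  linear_diff[OF L.linear_reflection] linear_neg[OF L.linear_reflection] linear_scale[OF L.linear_reflection]
lemmas \<sigma>_linear = linear_0[OF M.linear_reflection] linear_add[OF M.linear_reflection]
  linear_diff[OF M.linear_reflection] linear_neg[OF M.linear_reflection] linear_scale[OF M.linear_reflection]

lemma \<tau>_cscale: "\<tau> (jscale J z x) = jscale J (cnj z) (\<tau> x)"
  by (simp add: jscale_def \<tau>_linear L.reflection_J)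

lemma \<sigma>_cscale: "\<sigma> (jscale J z x) = jscale J (cnj z) (\<sigma> x)"
  by (simp add: jscale_def \<sigma>_linear M.reflection_J)

lemma complex_isometry_W: "complex_isometry \<omega> J W"
proof (intro complex_isometry.intro complex_isometry_axioms.intro M.symplectic_space_axioms)
  show "linear W" by (rule linearI) (simp_all add: W_def \<tau>_linear \<sigma>_linear)
  show "W (J x) = J (W x)" for x
    by (simp add: W_def L.reflection_J M.reflection_J \<sigma>_linear M.J_simps)
  show "norm (W x) = norm x" for x
    by (simp add: W_def L.norm_reflection M.norm_reflection)
qed

text \<open>Solving \<open>W\<^sub>2 p - z p = (u, v)\<close> by elimination: the second equation determines the second component of
  \<open>p\<close> as below, and the first one then becomes an equation for \<open>W + z\<^sup>2\<close>.  The vectors displayed are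
  those that solve the second equation.\<close>

lemma W2_minus_scale:
  assumes z: "cmod z = 1"
  shows "W\<^sub>2 (x, - jscale J z (v + \<tau> x)) - jscale (box_J J) z (x, - jscale J z (v + \<tau> x))
    = (jscale J (cnj z) (\<sigma> v - (W x - jscale J (- z\<^sup>2) x)), v)"
proof -
  have zz: "cnj z * z = 1" "z * cnj z = 1"
    using z by (metis complex_norm_square mult.commute of_real_1 power_one)+
  have "cnj z * - z\<^sup>2 = - z" using zz(1) by (simp add: power2_eq_square mult.assoc[symmetric])
  then show ?thesis
    using zz
    by (simp add: W\<^sub>2_def jscale_box \<sigma>_cscale \<sigma>_linear W_def M.C.scale_right_distrib
        M.C.scale_right_diff_distrib)
qed

lemma W2_equation:
  assumes z: "cmod z = 1" and eq: "W\<^sub>2 (x, y) - jscale (box_J J) z (x, y) = (u, v)"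
  shows "y = - jscale J z (v + \<tau> x)"
proof -
  have zz: "z * cnj z = 1" using z by (simp add: complex_norm_square[symmetric])
  have "- \<tau> x - jscale J (cnj z) y = v" using eq by (simp add: W\<^sub>2_def jscale_box)
  then have "jscale J (cnj z) y = - (v + \<tau> x)" by (metis add.commute diff_eq_eq minus_add_distrib minus_diff_eq uminus_add_conv_diff)
  then have "jscale J z (jscale J (cnj z) y) = jscale J z (- (v + \<tau> x))" by (rule arg_cong)
  then show ?thesis by (simp only: M.C.scale_scale zz M.C.scale_one M.C.scale_minus_right)
qed

lemma eigenspace_box:
  assumes z: "cmod z = 1"
  shows "eigenspace (box_J J) W\<^sub>2 z = (\<lambda>x. (x, - jscale J z (\<tau> x))) ` eigenspace J W (- z\<^sup>2)"
proof (intro equalityI subsetI)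
  fix p assume "p \<in> eigenspace (box_J J) W\<^sub>2 z"
  then have e: "W\<^sub>2 p - jscale (box_J J) z p = (0, 0)" by (simp add: eigenspace_def zero_prod_def)
  obtain x y where p: "p = (x, y)" by (cases p)
  have y: "y = - jscale J z (0 + \<tau> x)" by (rule W2_equation[OF z e[unfolded p]])
  have "jscale J (cnj z) (\<sigma> 0 - (W x - jscale J (- z\<^sup>2) x)) = 0"
    using e W2_minus_scale[OF z, of x 0] unfolding p y by simp
  moreover have "cnj z \<noteq> 0" using z by auto
  ultimately have "0 - (W x - jscale J (- z\<^sup>2) x) = 0"
    by (simp only: M.C.scale_eq_0_iff \<sigma>_linear simp_thms)
  then have "W x - jscale J (- z\<^sup>2) x = 0" by (simp only: diff_0 neg_equal_0_iff_equal)
  then show "p \<in> (\<lambda>x. (x, - jscale J z (\<tau> x))) ` eigenspace J W (- z\<^sup>2)"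
    unfolding p y by (simp add: eigenspace_def image_iff)
next
  fix p assume "p \<in> (\<lambda>x. (x, - jscale J z (\<tau> x))) ` eigenspace J W (- z\<^sup>2)"
  then obtain x where x: "W x - jscale J (- z\<^sup>2) x = 0" "p = (x, - jscale J z (0 + \<tau> x))"
    by (auto simp: eigenspace_def)
  then show "p \<in> eigenspace (box_J J) W\<^sub>2 z"
    using W2_minus_scale[OF z, of x 0] unfolding x(1)
    by (simp add: eigenspace_def \<sigma>_linear zero_prod_def)
qed

text \<open>Both \<open>\<tau>\<close> and the complex structure \<open>- J\<close> of the second factor introduce a conjugation, and the two
  cancel.\<close>

lemma linear_graph:
  "Vector_Spaces.linear (jscale J) (jscale (box_J J)) (\<lambda>x. (x, - jscale J z (\<tau> x)))"
  unfolding Vector_Spaces.linear_iff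
  using vector_space_jscale[OF M.symplectic] vector_space_jscale[OF symplectic_hilbert_box[OF M.symplectic]]
  by (simp add: \<tau>_linear \<tau>_cscale jscale_box M.C.scale_right_distrib mult.commute)

lemma eigenspace_box_facts:
  assumes z: "cmod z = 1"
  shows "eigenspace (box_J J) W\<^sub>2 z \<noteq> {0} \<longleftrightarrow> eigenspace J W (- z\<^sup>2) \<noteq> {0}"
    and "vector_space.dim (jscale (box_J J)) (eigenspace (box_J J) W\<^sub>2 z)
      = vector_space.dim (jscale J) (eigenspace J W (- z\<^sup>2))"
    and "(\<exists>B. finite B \<and> module.span (jscale (box_J J)) B = eigenspace (box_J J) W\<^sub>2 z)
      \<longleftrightarrow> (\<exists>B. finite B \<and> module.span (jscale J) B = eigenspace J W (- z\<^sup>2))"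
proof -
  interpret W: complex_isometry \<omega> J W by (rule complex_isometry_W)
  have i: "inj (\<lambda>x. (x, - jscale J z (\<tau> x)))" by (auto simp: inj_def)
  show "vector_space.dim (jscale (box_J J)) (eigenspace (box_J J) W\<^sub>2 z)
      = vector_space.dim (jscale J) (eigenspace J W (- z\<^sup>2))"
    unfolding eigenspace_box[OF z] by (rule dim_image_injective[OF linear_graph i W.subspace_eig])
  show "(\<exists>B. finite B \<and> module.span (jscale (box_J J)) B = eigenspace (box_J J) W\<^sub>2 z)
      \<longleftrightarrow> (\<exists>B. finite B \<and> module.span (jscale J) B = eigenspace J W (- z\<^sup>2))"
    unfolding eigenspace_box[OF z] by (rule finite_span_image_injective[OF linear_graph i])
  have "(\<lambda>x. (x, - jscale J z (\<tau> x))) ` {0} = {0}" by (simp add: \<tau>_linear zero_prod_def)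
  then show "eigenspace (box_J J) W\<^sub>2 z \<noteq> {0} \<longleftrightarrow> eigenspace J W (- z\<^sup>2) \<noteq> {0}"
    unfolding eigenspace_box[OF z] using inj_image_eq_iff[OF i] by metis
qed

lemma bounded_linear_jscale: "bounded_linear (jscale J c)"
  by (rule bounded_linear_intro[of _ "cmod c"])
    (auto simp: linear_add[OF M.linear_cscale] linear_scale[OF M.linear_cscale] M.norm_cscale)

lemma invertible_box_iff:
  assumes z: "cmod z = 1"
  shows "invertible_op (\<lambda>p. W\<^sub>2 p - jscale (box_J J) z p) \<longleftrightarrow> invertible_op (\<lambda>x. W x - jscale J (- z\<^sup>2) x)"
    (is "invertible_op ?T\<^sub>2 \<longleftrightarrow> invertible_op ?T")
proof
  have zz: "z * cnj z = 1" "cnj z * z = 1"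
    using z by (metis complex_norm_square mult.commute of_real_1 power_one)+
  have zz2: "jscale J z (jscale J (cnj z) x) = x" "jscale J (cnj z) (jscale J z x) = x" for x
    by (simp_all only: M.C.scale_scale zz M.C.scale_one)
  have T2: "?T\<^sub>2 (x, - jscale J z (v + \<tau> x)) = (jscale J (cnj z) (\<sigma> v - ?T x), v)" for x v
    by (rule W2_minus_scale[OF z])
  {
    assume "invertible_op ?T\<^sub>2"
    then obtain S where S: "bounded_linear S" and ST: "\<And>p. S (?T\<^sub>2 p) = p" and TS: "\<And>p. ?T\<^sub>2 (S p) = p"
      unfolding invertible_op_iff by blast
    define R where "R w = fst (S (- jscale J (cnj z) w, 0))" for w
    have "bounded_linear R"
      unfolding R_def
      by (intro bounded_linear_compose[OF bounded_linear_fst] bounded_linear_compose[OF S]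
          bounded_linear_Pair bounded_linear_minus bounded_linear_jscale bounded_linear_zero)
    moreover have "R (?T x) = x" for x
    proof -
      have "S (?T\<^sub>2 (x, - jscale J z (0 + \<tau> x))) = (x, - jscale J z (0 + \<tau> x))" by (rule ST)
      then have "S (- jscale J (cnj z) (?T x), 0) = (x, - jscale J z (0 + \<tau> x))"
        unfolding T2 by (simp only: \<sigma>_linear diff_0 M.C.scale_minus_right)
      then show ?thesis by (simp add: R_def)
    qed
    moreover have "?T (R w) = w" for w
    proof -
      obtain x y where xy: "S (- jscale J (cnj z) w, 0) = (x, y)" by (cases "S (- jscale J (cnj z) w, 0)")
      have e: "?T\<^sub>2 (x, y) = (- jscale J (cnj z) w, 0)" using TS xy by metis
      have y: "y = - jscale J z (0 + \<tau> x)" by (rule W2_equation[OF z e])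
      have "jscale J (cnj z) (\<sigma> 0 - ?T x) = - jscale J (cnj z) w"
        using e unfolding y T2 by simp
      then have "jscale J (cnj z) (?T x) = jscale J (cnj z) w"
        by (simp only: \<sigma>_linear diff_0 M.C.scale_minus_right neg_equal_iff_equal)
      then have "?T x = w" using zz2(1) by metis
      then show ?thesis by (simp add: R_def xy)
    qed
    ultimately show "invertible_op ?T"
      unfolding invertible_op_iff by blast
  next
    assume "invertible_op ?T"
    then obtain S where S: "bounded_linear S" and ST: "\<And>x. S (?T x) = x" and TS: "\<And>x. ?T (S x) = x"
      unfolding invertible_op_iff by blast
    define X where "X p = S (\<sigma> (snd p) - jscale J z (fst p))" for p
    define R where "R p = (X p, - jscale J z (snd p + \<tau> (X p)))" for p
    have X: "bounded_linear X"
      unfolding X_def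
      by (intro bounded_linear_compose[OF S] bounded_linear_sub bounded_linear_compose[OF bounded_linear_jscale]
          bounded_linear_compose[OF M.bounded_linear_reflection] bounded_linear_fst bounded_linear_snd)
    have "bounded_linear R"
      unfolding R_def
      by (intro bounded_linear_Pair X bounded_linear_minus bounded_linear_compose[OF bounded_linear_jscale]
          bounded_linear_add bounded_linear_snd bounded_linear_compose[OF L.bounded_linear_reflection])
    moreover have "?T\<^sub>2 (R p) = p" for p
    proof -
      have "?T (X p) = \<sigma> (snd p) - jscale J z (fst p)" unfolding X_def by (rule TS)
      then show ?thesis unfolding R_def T2 by (simp add: zz)
    qed
    moreover have "R (?T\<^sub>2 p) = p" for p
    proof -
      obtain x y where p: "p = (x, y)" by (cases p)
      obtain u v where uv: "?T\<^sub>2 (x, y) = (u, v)" by (cases "?T\<^sub>2 (x, y)")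
      have y: "y = - jscale J z (v + \<tau> x)" by (rule W2_equation[OF z uv])
      have "jscale J (cnj z) (\<sigma> v - ?T x) = u" using uv unfolding y T2 by simp
      then have "\<sigma> v - jscale J z u = ?T x" using zz2(1) by (metis diff_diff_eq2 add_diff_cancel_left')
      then have "X (u, v) = x" unfolding X_def using ST by simp
      then show ?thesis unfolding p uv R_def by (simp add: y)
    qed
    ultimately show "invertible_op ?T\<^sub>2"
      unfolding invertible_op_iff by blast
  }
qed

text \<open>The point at angle \<open>t\<close> from \<open>- 1\<close> corresponds to the point at angle \<open>2 t\<close> from \<open>- 1\<close>.\<close>

lemma cis_double: "- (cis (pi + t))\<^sup>2 = cis (pi + 2 * t)"
  by (simp add: cis_pi_add Complex.DeMoivre)

lemma arc_admissible_box_iff: "arc_admissible (box_J J) W\<^sub>2 d \<longleftrightarrow> arc_admissible J W (2 * d)"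
proof -
  define A where "A = spectrum_op J W \<inter> {cis (pi + t) |t. \<bar>t\<bar> \<le> 2 * d}"
  define A\<^sub>2 where "A\<^sub>2 = spectrum_op (box_J J) W\<^sub>2 \<inter> {cis (pi + t) |t. \<bar>t\<bar> \<le> d}"
  have unit: "cmod z = 1" if "z \<in> A\<^sub>2" for z using that by (auto simp: A\<^sub>2_def)
  have A: "A = (\<lambda>z. - z\<^sup>2) ` A\<^sub>2"
  proof (intro equalityI subsetI)
    fix w assume "w \<in> A"
    then obtain t where t: "w = cis (pi + 2 * (t / 2))" "\<bar>t / 2\<bar> \<le> d" "w \<in> spectrum_op J W"
      by (auto simp: A_def)
    then have "cis (pi + t / 2) \<in> A\<^sub>2"
      using invertible_box_iff[of "cis (pi + t / 2)"] unfolding cis_double[symmetric] A\<^sub>2_def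
      by (auto simp: spectrum_op_def)
    then show "w \<in> (\<lambda>z. - z\<^sup>2) ` A\<^sub>2" unfolding t(1) cis_double[symmetric] by blast
  next
    fix w assume "w \<in> (\<lambda>z. - z\<^sup>2) ` A\<^sub>2"
    then obtain t where t: "w = - (cis (pi + t))\<^sup>2" "\<bar>t\<bar> \<le> d" "cis (pi + t) \<in> spectrum_op (box_J J) W\<^sub>2"
      by (auto simp: A\<^sub>2_def)
    then have "w \<in> spectrum_op J W"
      using invertible_box_iff[of "cis (pi + t)"] by (simp add: spectrum_op_def)
    moreover have "w = cis (pi + 2 * t)" using t(1) cis_double by simp
    ultimately show "w \<in> A" using t(2) by (auto simp: A_def)
  qed
  have fin: "finite A\<^sub>2 \<longleftrightarrow> finite A"
  proof
    assume "finite A"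
    have "finite {z. z\<^sup>2 = c}" for c :: complex
    proof (rule finite_subset)
      show "{z. z\<^sup>2 = c} \<subseteq> {csqrt c, - csqrt c}"
      proof
        fix z assume "z \<in> {z. z\<^sup>2 = c}"
        then have "z\<^sup>2 = (csqrt c)\<^sup>2" by simp
        then show "z \<in> {csqrt c, - csqrt c}" unfolding power2_eq_iff by blast
      qed
    qed simp
    then have "finite (\<Union>w\<in>A. {z. z\<^sup>2 = - w})" using \<open>finite A\<close> by auto
    moreover have "A\<^sub>2 \<subseteq> (\<Union>w\<in>A. {z. z\<^sup>2 = - w})" unfolding A by auto
    ultimately show "finite A\<^sub>2" using finite_subset by blast
  qed (simp add: A)
  show ?thesis
    unfolding arc_admissible_def A_def[symmetric] A\<^sub>2_def[symmetric] fin
      invertible_box_iff[OF norm_cis] cis_double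
    using eigenspace_box_facts(1,3)[OF unit] by (simp add: A)
qed

lemma maslov_count_box: "maslov_count (box_J J) W\<^sub>2 d = maslov_count J W (2 * d)"
proof -
  have u: "cmod (cis (pi + t)) = 1" for t by simp
  have "maslov_count (box_J J) W\<^sub>2 d =
     (\<Sum>\<theta> | 0 \<le> \<theta> \<and> \<theta> \<le> d \<and> eigenspace J W (cis (pi + 2 * \<theta>)) \<noteq> {0}.
        vector_space.dim (jscale J) (eigenspace J W (cis (pi + 2 * \<theta>))))"
    unfolding maslov_count_def eigenspace_box_facts[OF u] cis_double ..
  also have "\<dots> = maslov_count J W (2 * d)"
    unfolding maslov_count_def
    by (rule sum.reindex_bij_witness[of _ "\<lambda>t. t / 2" "\<lambda>t. 2 * t"]) auto
  finally show ?thesis .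
qed

end

section \<open>The Maslov index of the doubled path\<close>

lemma souriau_path_continuous:
  assumes \<mu>: "\<And>s. s \<in> {0..1} \<Longrightarrow> lagrangian_pair \<omega> J (\<mu> s) L"
    and cont: "continuous_path \<mu>" and s: "s \<in> {0..1}" and \<eta>: "0 < \<eta>"
  shows "\<exists>d>0. \<forall>s'\<in>{0..1}. \<bar>s' - s\<bar> < d \<longrightarrow>
    (\<forall>x. norm (lagrangian_pair.W (\<mu> s') L x - lagrangian_pair.W (\<mu> s) L x) \<le> \<eta> * norm x)"
proof -
  have "continuous_on {0..1} (\<lambda>t. Blinfun (orth_proj (\<mu> t)))"
    using cont by (simp add: continuous_path_def)
  then obtain d where d: "d > 0" "\<And>s'. s' \<in> {0..1} \<Longrightarrow> dist s' s < d \<Longrightarrow>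
      dist (Blinfun (orth_proj (\<mu> s'))) (Blinfun (orth_proj (\<mu> s))) < \<eta> / 2"
    using s \<eta> unfolding continuous_on_iff by (metis half_gt_zero)
  have "norm (lagrangian_pair.W (\<mu> s') L x - lagrangian_pair.W (\<mu> s) L x) \<le> \<eta> * norm x"
    if s': "s' \<in> {0..1}" "\<bar>s' - s\<bar> < d" for s' x
  proof -
    interpret S: lagrangian_pair \<omega> J "\<mu> s" L by (rule \<mu>[OF s])
    interpret S': lagrangian_pair \<omega> J "\<mu> s'" L by (rule \<mu>[OF s'(1)])
    let ?y = "reflection L x"
    let ?B = "\<lambda>s. Blinfun (orth_proj (\<mu> s))"
    have B: "blinfun_apply (?B s) = orth_proj (\<mu> s)" "blinfun_apply (?B s') = orth_proj (\<mu> s')"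
      by (simp_all add: bounded_linear_Blinfun_apply S.M.bounded_linear_orth_proj S'.M.bounded_linear_orth_proj)
    have "S'.W x - S.W x = - (2 *\<^sub>R (?B s' - ?B s) ?y)"
      by (simp add: S.W_def S'.W_def reflection_def B blinfun.diff_left algebra_simps)
    then have "norm (S'.W x - S.W x) = 2 * norm ((?B s' - ?B s) ?y)" by simp
    also have "\<dots> \<le> 2 * (norm (?B s' - ?B s) * norm x)"
      using norm_blinfun[of "?B s' - ?B s" ?y] by (simp add: S.L.norm_reflection)
    also have "\<dots> \<le> \<eta> * norm x"
    proof -
      have "2 * norm (?B s' - ?B s) \<le> \<eta>" using d(2)[OF s'(1)] s'(2) by (simp add: dist_norm)
      then have "2 * norm (?B s' - ?B s) * norm x \<le> \<eta> * norm x" by (rule mult_right_mono) simp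
      then show ?thesis by simp
    qed
    finally show ?thesis .
  qed
  then show ?thesis using d(1) by blast
qed

theorem proposition2p14:
  fixes \<omega> :: "'a::{real_inner, complete_space} \<Rightarrow> 'a \<Rightarrow> real"
    and J :: "'a \<Rightarrow> 'a"
    and L :: "'a set"
    and \<mu> :: "real \<Rightarrow> 'a set"
  assumes "separable_space (euclidean :: 'a topology)"
    and "symplectic_hilbert \<omega> J"
    and "lagrangian \<omega> L"
    and "\<forall>t\<in>{0..1}. \<mu> t \<in> fredholm_lagrangian \<omega> L"
    and "continuous_path \<mu>"
  shows "Mas \<omega> J \<mu> L = Mas (box_form \<omega>) (box_J J) (\<lambda>t. \<mu> t \<times> L) diagonal"
proof -
  have pair: "lagrangian_pair \<omega> J (\<mu> s) L" if "s \<in> {0..1}" for s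
    using assms that by unfold_locales (auto simp: fredholm_lagrangian_def)
  define W where "W s = souriau \<omega> J L (\<mu> s)" for s
  define W' where "W' s = souriau (box_form \<omega>) (box_J J) diagonal (\<mu> s \<times> L)" for s
  have W: "W s = lagrangian_pair.W (\<mu> s) L" if "s \<in> {0..1}" for s
    unfolding W_def by (rule lagrangian_pair.souriau_eq_W[OF pair[OF that]])
  have iso: "complex_isometry \<omega> J (W s)" if "s \<in> {0..1}" for s
    unfolding W[OF that] by (rule lagrangian_pair.complex_isometry_W[OF pair[OF that]])
  have adm: "arc_admissible (box_J J) (W' s) d \<longleftrightarrow> arc_admissible J (W s) (2 * d)"
    and count: "maslov_count (box_J J) (W' s) d = maslov_count J (W s) (2 * d)"
    if "s \<in> {0..1}" for s d
    unfolding W[OF that] W'_def lagrangian_pair.souriau_box_eq_W2[OF pair[OF that]]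
    by (rule lagrangian_pair.arc_admissible_box_iff lagrangian_pair.maslov_count_box, rule pair[OF that])+
  \<comment> \<open>An arc for the original path becomes an arc of half the length for the doubled path.\<close>
  have to_box: "chain (maslov_step (box_J J) W') b c k"
    if bc: "0 \<le> b" "b < c" "c \<le> 1" and step: "maslov_step J W b c k" for b c k
  proof -
    obtain e where e: "0 < e" "e < pi" "\<And>s. s \<in> {b..c} \<Longrightarrow> arc_admissible J (W s) e"
      "k = int (maslov_count J (W c) e) - int (maslov_count J (W b) e)"
      using step unfolding maslov_step_def by blast
    have "maslov_step (box_J J) W' b c k"
      unfolding maslov_step_def using e bc adm[of _ "e / 2"] count[of _ "e / 2"]
      by (intro exI[of _ "e / 2"]) auto
    then show ?thesis using bc by (intro chain_single)
  qed
  \<comment> \<open>Conversely an arc doubles in length; when it then covers the circle, the interval is subdivided.\<close>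
  have from_box: "chain (maslov_step J W) b c k"
    if bc: "0 \<le> b" "b < c" "c \<le> 1" and step: "maslov_step (box_J J) W' b c k" for b c k
  proof -
    obtain d where d: "0 < d" "d < pi" "\<And>s. s \<in> {b..c} \<Longrightarrow> arc_admissible (box_J J) (W' s) d"
      "k = int (maslov_count (box_J J) (W' c) d) - int (maslov_count (box_J J) (W' b) d)"
      using step unfolding maslov_step_def by blast
    have d_adm: "arc_admissible J (W s) (2 * d)" if "s \<in> {b..c}" for s
      using d(3)[OF that] adm[of s d] that bc by auto
    have k: "k = int (maslov_count J (W c) (2 * d)) - int (maslov_count J (W b) (2 * d))"
      using d(4) count[of b d] count[of c d] bc by simp
    show ?thesis
    proof (cases "2 * d < pi")
      case True
      then have "maslov_step J W b c k"
        unfolding maslov_step_def using d(1) d_adm k by (intro exI[of _ "2 * d"]) auto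
      then show ?thesis using bc by (intro chain_single)
    next
      case False
      have "\<exists>\<delta>>0. \<forall>s'\<in>{b..c}. \<bar>s' - s\<bar> < \<delta> \<longrightarrow> (\<forall>x. norm (W s' x - W s x) \<le> \<eta> * norm x)"
        if s: "s \<in> {b..c}" and \<eta>: "0 < \<eta>" for s \<eta>
      proof -
        have s01: "s \<in> {0..1}" using s bc by auto
        obtain \<delta> where "\<delta> > 0" and \<delta>: "\<And>s' x. s' \<in> {0..1} \<Longrightarrow> \<bar>s' - s\<bar> < \<delta> \<Longrightarrow>
            norm (lagrangian_pair.W (\<mu> s') L x - lagrangian_pair.W (\<mu> s) L x) \<le> \<eta> * norm x"
          using souriau_path_continuous[OF pair assms(5) s01 \<eta>] by blast
        moreover have "norm (W s' x - W s x) \<le> \<eta> * norm x"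
          if "s' \<in> {b..c}" "\<bar>s' - s\<bar> < \<delta>" for s' x
        proof -
          have "s' \<in> {0..1}" using that(1) bc by auto
          then show ?thesis using \<delta>[of s' x] that(2) W s01 by simp
        qed
        ultimately show ?thesis by blast
      qed
      then show ?thesis
        unfolding k using False d(2) bc iso d_adm by (intro long_arc_chain[where \<omega> = \<omega>]) auto
    qed
  qed
  have "chain (maslov_step J W) 0 1 m = chain (maslov_step (box_J J) W') 0 1 m" for m
    using chain_refine[of "maslov_step J W" 0 1 m 0 1 "maslov_step (box_J J) W'"]
      chain_refine[of "maslov_step (box_J J) W'" 0 1 m 0 1 "maslov_step J W"] to_box from_box
    by auto
  then have "chain (maslov_step J W) 0 1 = chain (maslov_step (box_J J) W') 0 1" by (rule ext)
  then show ?thesis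
    unfolding Mas_def maslov_M_chain W_def[symmetric] W'_def[symmetric] by simp
qed

end
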